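(* Let $K$ be a field trivially graded by $\mathbb Z$, let $m$ and $n$ be positive integers and $\gamma_1,\gamma_2,\ldots,\gamma_n$ arbitrary integers. (1) $\mathbb M_n(K)(\gamma_1,\gamma_2,\ldots,\gamma_n)$ is graded unit-regular if and only if $n=1$ or $\gamma_1=\gamma_2=\cdots=\gamma_n$. (2) If the list $\gamma_1,\ldots,\gamma_n$ is such that all of $0,1,\ldots,m-1$ appear on it when it is considered modulo $m$, then $\mathbb M_n(K[x^m,x^{-m}])(\gamma_1,\ldots,\gamma_n)$ is graded unit-regular if and only if $n=km$ for some positive integer $k$ and the list $\gamma_1,\ldots,\gamma_n$, considered modulo $m$, is such that each $i=0,1,\ldots,m-1$ appears exactly $k$ times.
   Context: $K$ is trivially $\mathbb Z$-graded: $K_0=K$ and $K_n=0$ for $n\neq0$. The Laurent polynomial ring $K[x^m,x^{-m}]$ is $\mathbb Z$-graded by $K[x^m,x^{-m}]_{mk}=Kx^{mk}$ for $k\in\mathbb Z$ and $K[x^m,x^{-m}]_l=0$ if $m$ does not divide $l$. For a $\mathbb Z$-graded ring $R$ and integers $\gamma_1,\dots,\gamma_n$, $\mathbb M_n(R)(\gamma_1,\dots,\gamma_n)$ is the matrix ring $\mathbb M_n(R)$ with the $\mathbb Z$-grading in which $(r_{ij})$ has degree $\delta$ if $r_{ij}\in R_{-\gamma_i+\delta+\gamma_j}$ for all $i,j=1,\dots,n$. A graded ring $R$ is graded unit-regular if for every homogeneous $x\in R$ there is a homogeneous invertible $u\in R$ with $xux=x$. *)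

theory Defs
  imports "HOL-Library.Poly_Mapping" "HOL-Algebra.AbelCoset" "Jordan_Normal_Form.VS_Connect"
begin

text \<open>
  A \<open>\<int>\<close>-graded ring: a ring that is the internal direct sum of additive subgroups
  \<open>C d\<close> (\<open>d \<in> \<int>\<close>) such that \<open>C d \<otimes> C e \<subseteq> C (d + e)\<close>.
\<close>

locale graded_ring = ring R for R (structure) +
  fixes C :: "int \<Rightarrow> 'a set"
  assumes component_subgroup: "additive_subgroup (C d) R"
    and component_mult: "\<lbrakk>x \<in> C d; y \<in> C e\<rbrakk> \<Longrightarrow> x \<otimes> y \<in> C (d + e)"
    and components_span:
      "x \<in> carrier R \<Longrightarrow> \<exists>D f. finite D \<and> (\<forall>d\<in>D. f d \<in> C d) \<and> x = (\<Oplus>d\<in>D. f d)"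
    and components_independent:
      "\<lbrakk>finite D; \<forall>d\<in>D. f d \<in> C d; (\<Oplus>d\<in>D. f d) = \<zero>\<rbrakk> \<Longrightarrow> \<forall>d\<in>D. f d = \<zero>"

text \<open>The homogeneous elements, among them \<open>\<zero>\<close>, are those of \<open>\<Union>d. C d\<close>.\<close>

definition graded_unit_regular :: "('a, 'b) ring_scheme \<Rightarrow> (int \<Rightarrow> 'a set) \<Rightarrow> bool" where
  "graded_unit_regular R C \<longleftrightarrow> graded_ring R C \<and>
     (\<forall>x \<in> (\<Union>d. C d). \<exists>u \<in> (\<Union>d. C d) \<inter> Units R. x \<otimes>\<^bsub>R\<^esub> u \<otimes>\<^bsub>R\<^esub> x = x)"

definition trivial_grading :: "('a, 'b) ring_scheme \<Rightarrow> int \<Rightarrow> 'a set" where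
  "trivial_grading R d = (if d = 0 then carrier R else {\<zero>\<^bsub>R\<^esub>})"

text \<open>
  \<open>K[x\<^sup>m, x\<^sup>-\<^sup>m]\<close> inside the Laurent polynomial ring \<open>K[x, x\<^sup>-\<^sup>1]\<close>. The latter is the type of
  finitely supported functions \<open>int \<Rightarrow>\<^sub>0 K\<close> with convolution as multiplication; the monomial
  \<open>c x\<^sup>l\<close> is \<open>Poly_Mapping.single l c\<close>.
\<close>

definition laurent_ring :: "nat \<Rightarrow> (int \<Rightarrow>\<^sub>0 'a::field) ring" where
  "laurent_ring m = class_ring\<lparr>carrier := {p. \<forall>l \<in> Poly_Mapping.keys p. int m dvd l}\<rparr>"

definition laurent_grading :: "nat \<Rightarrow> int \<Rightarrow> (int \<Rightarrow>\<^sub>0 'a::field) set" where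
  "laurent_grading m l = (if int m dvd l then range (Poly_Mapping.single l) else {0})"

text \<open>
  The matrix ring over an arbitrary ring record \<open>R\<close>. The library's \<open>ring_mat\<close> is the case where
  \<open>R\<close> is all of a type of class \<open>semiring_1\<close>, which does not cover \<open>K[x\<^sup>m, x\<^sup>-\<^sup>m]\<close>.
\<close>

definition matrix_ring :: "('a, 'b) ring_scheme \<Rightarrow> nat \<Rightarrow> 'a mat ring" where
  "matrix_ring R n =
    \<lparr> carrier = {A \<in> carrier_mat n n. \<forall>i<n. \<forall>j<n. A $$ (i, j) \<in> carrier R},
      mult = (\<lambda>A B. mat n n (\<lambda>(i, j). \<Oplus>\<^bsub>R\<^esub>k\<in>{..<n}. A $$ (i, k) \<otimes>\<^bsub>R\<^esub> B $$ (k, j))),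
      one = mat n n (\<lambda>(i, j). if i = j then \<one>\<^bsub>R\<^esub> else \<zero>\<^bsub>R\<^esub>),
      zero = mat n n (\<lambda>(i, j). \<zero>\<^bsub>R\<^esub>),
      add = (\<lambda>A B. mat n n (\<lambda>(i, j). A $$ (i, j) \<oplus>\<^bsub>R\<^esub> B $$ (i, j))) \<rparr>"

text \<open>
  The grading of \<open>\<bbbM>\<^sub>n(R)(\<gamma>\<^sub>1, \<dots>, \<gamma>\<^sub>n)\<close>, where \<open>C\<close> is the grading of \<open>R\<close>, \<open>\<gamma>\<close> is a list of
  length \<open>n\<close>, and indices start at 0.
\<close>

definition matrix_grading :: "(int \<Rightarrow> 'a set) \<Rightarrow> int list \<Rightarrow> int \<Rightarrow> 'a mat set" where
  "matrix_grading C \<gamma> \<delta> =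
    {A \<in> carrier_mat (length \<gamma>) (length \<gamma>).
       \<forall>i<length \<gamma>. \<forall>j<length \<gamma>. A $$ (i, j) \<in> C (- (\<gamma> ! i) + \<delta> + \<gamma> ! j)}"


subsection \<open>The rings above are graded rings\<close>

lemma graded_ring_trivial_grading:
  fixes R (structure)
  assumes "ring R"
  shows "graded_ring R (trivial_grading R)"
proof -
  interpret ring R by fact
  show ?thesis
  proof (intro graded_ring.intro graded_ring_axioms.intro)
    show "ring R" ..
  next
    fix d
    have "subgroup (carrier R) (add_monoid R)" "subgroup {\<zero>} (add_monoid R)"
      using add.subgroup_self add.triv_subgroup by auto
    then show "additive_subgroup (trivial_grading R d) R"
      by (simp add: trivial_grading_def additive_subgroup_def)
  next
    fix x y d e
    assume "x \<in> trivial_grading R d" "y \<in> trivial_grading R e"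
    then show "x \<otimes> y \<in> trivial_grading R (d + e)"
      by (auto simp: trivial_grading_def split: if_splits)
  next
    fix x assume "x \<in> carrier R"
    then show "\<exists>D f. finite D \<and> (\<forall>d\<in>D. f d \<in> trivial_grading R d) \<and> x = (\<Oplus>d\<in>D. f d)"
      by (intro exI[of _ "{0}"] exI[of _ "\<lambda>_. x"]) (auto simp: trivial_grading_def)
  next
    fix D and f :: "int \<Rightarrow> 'a"
    assume D: "finite D" "\<forall>d\<in>D. f d \<in> trivial_grading R d" "(\<Oplus>d\<in>D. f d) = \<zero>"
    have nz: "f d = \<zero>" if "d \<in> D" "d \<noteq> 0" for d
      using D(2) that by (auto simp: trivial_grading_def)
    have "f 0 = \<zero>" if "0 \<in> D"
    proof -
      have f0: "f 0 \<in> carrier R" using D(2) that by (auto simp: trivial_grading_def)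
      have "f d \<in> carrier R" if "d \<in> D" for d
        using nz[OF that] f0 by (cases "d = 0") auto
      then have "(\<Oplus>d\<in>D. f d) = (\<Oplus>d\<in>{0}. f d)"
        using D(1) that nz f0 by (intro add.finprod_mono_neutral_cong_right) auto
      then show ?thesis using D(3) f0 by simp
    qed
    then show "\<forall>d\<in>D. f d = \<zero>" using nz by metis
  qed
qed

lemma laurent_ring_simps [simp]:
  "carrier (laurent_ring m) = {p. \<forall>l \<in> Poly_Mapping.keys p. int m dvd l}"
  "mult (laurent_ring m) = (*)"
  "one (laurent_ring m) = 1"
  "zero (laurent_ring m) = 0"
  "add (laurent_ring m) = (+)"
  by (simp_all add: laurent_ring_def)

lemma ring_laurent_ring: "ring (laurent_ring m :: (int \<Rightarrow>\<^sub>0 'a::field) ring)"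
proof (rule ringI)
  show "abelian_group (laurent_ring m :: (int \<Rightarrow>\<^sub>0 'a::field) ring)"
  proof (rule abelian_groupI)
    fix x y :: "int \<Rightarrow>\<^sub>0 'a"
    assume "x \<in> carrier (laurent_ring m)" "y \<in> carrier (laurent_ring m)"
    then show "x \<oplus>\<^bsub>laurent_ring m\<^esub> y \<in> carrier (laurent_ring m)"
      using Poly_Mapping.keys_add[of x y] by auto
  next
    fix x :: "int \<Rightarrow>\<^sub>0 'a" assume "x \<in> carrier (laurent_ring m)"
    then show "\<exists>y \<in> carrier (laurent_ring m). y \<oplus>\<^bsub>laurent_ring m\<^esub> x = \<zero>\<^bsub>laurent_ring m\<^esub>"
      by (intro bexI[of _ "- x"]) auto
  qed (auto simp: algebra_simps)
  show "monoid (laurent_ring m :: (int \<Rightarrow>\<^sub>0 'a::field) ring)"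
  proof (rule monoidI)
    fix x y :: "int \<Rightarrow>\<^sub>0 'a"
    assume "x \<in> carrier (laurent_ring m)" "y \<in> carrier (laurent_ring m)"
    then show "x \<otimes>\<^bsub>laurent_ring m\<^esub> y \<in> carrier (laurent_ring m)"
      using Poly_Mapping.keys_mult[of x y] by (auto intro!: dvd_add)
  qed (auto simp: algebra_simps)
qed (auto simp: algebra_simps)

lemma finsum_laurent_ring:
  assumes "finite D" "\<And>d. d \<in> D \<Longrightarrow> f d \<in> carrier (laurent_ring m)"
  shows "finsum (laurent_ring m) f D = sum f D"
proof -
  interpret L: ring "laurent_ring m" by (rule ring_laurent_ring)
  show ?thesis
    using assms
  proof (induction D rule: finite_induct)
    case (insert d D)
    then have "f d \<in> carrier (laurent_ring m)" "f \<in> D \<rightarrow> carrier (laurent_ring m)"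
      by blast+
    moreover have "finsum (laurent_ring m) f D = sum f D" using insert by blast
    ultimately show ?case using insert.hyps by simp
  qed simp
qed

lemma laurent_grading_subset: "laurent_grading m l \<subseteq> carrier (laurent_ring m)"
  by (auto simp: laurent_grading_def split: if_splits)

lemma graded_ring_laurent:
  "graded_ring (laurent_ring m :: (int \<Rightarrow>\<^sub>0 'a::field) ring) (laurent_grading m)"
proof -
  let ?L = "laurent_ring m :: (int \<Rightarrow>\<^sub>0 'a) ring"
  interpret L: ring ?L by (rule ring_laurent_ring)
  show ?thesis
  proof (intro graded_ring.intro graded_ring_axioms.intro)
    show "ring ?L" ..
  next
    fix d
    show "additive_subgroup (laurent_grading m d) ?L"
    proof (intro additive_subgroupI L.add.subgroupI)
      show "laurent_grading m d \<subseteq> carrier ?L"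
        using laurent_grading_subset by simp
      show "laurent_grading m d \<noteq> ({} :: (int \<Rightarrow>\<^sub>0 'a) set)"
        by (auto simp: laurent_grading_def)
    next
      fix a :: "int \<Rightarrow>\<^sub>0 'a" assume a: "a \<in> laurent_grading m d"
      then have ac: "a \<in> carrier ?L" "- a \<in> carrier ?L" 
        using laurent_grading_subset[of m d] by auto
      have "\<ominus>\<^bsub>?L\<^esub> a = - a"
        by (rule L.minus_equality) (use ac in auto)
      moreover have "- a \<in> laurent_grading m d"
        using a by (auto simp: laurent_grading_def single_uminus[symmetric])
      ultimately show "\<ominus>\<^bsub>?L\<^esub> a \<in> laurent_grading m d" by simp
    next
      fix a b :: "int \<Rightarrow>\<^sub>0 'a"
      assume "a \<in> laurent_grading m d" "b \<in> laurent_grading m d"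
      then show "a \<oplus>\<^bsub>?L\<^esub> b \<in> laurent_grading m d"
        by (auto simp: laurent_grading_def single_add[symmetric])
    qed
  next
    fix x y :: "int \<Rightarrow>\<^sub>0 'a" and d e
    assume "x \<in> laurent_grading m d" "y \<in> laurent_grading m e"
    moreover have "0 \<in> laurent_grading m (d + e)"
      by (auto simp: laurent_grading_def image_iff intro!: exI[of _ 0])
    ultimately show "x \<otimes>\<^bsub>?L\<^esub> y \<in> laurent_grading m (d + e)"
      by (auto simp: laurent_grading_def mult_single split: if_splits)
  next
    fix x :: "int \<Rightarrow>\<^sub>0 'a" assume x: "x \<in> carrier ?L"
    let ?f = "\<lambda>l. Poly_Mapping.single l (Poly_Mapping.lookup x l)"
    have f: "?f l \<in> laurent_grading m l" if "l \<in> Poly_Mapping.keys x" for l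
      using x that by (auto simp: laurent_grading_def)
    have "x = (\<Sum>l\<in>Poly_Mapping.keys x. ?f l)"
      by (rule poly_mapping_eqI)
        (simp add: lookup_sum lookup_single when_def in_keys_iff)
    then have "x = (\<Oplus>\<^bsub>?L\<^esub>l\<in>Poly_Mapping.keys x. ?f l)"
      using f laurent_grading_subset
      by (subst finsum_laurent_ring) (blast | simp)+
    then show "\<exists>D f. finite D \<and> (\<forall>d\<in>D. f d \<in> laurent_grading m d) \<and> x = (\<Oplus>\<^bsub>?L\<^esub>d\<in>D. f d)"
      using f by (intro exI[of _ "Poly_Mapping.keys x"] exI[of _ ?f]) auto
  next
    fix D and f :: "int \<Rightarrow> int \<Rightarrow>\<^sub>0 'a"
    assume D: "finite D" "\<forall>d\<in>D. f d \<in> laurent_grading m d" "(\<Oplus>\<^bsub>?L\<^esub>d\<in>D. f d) = \<zero>\<^bsub>?L\<^esub>"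
    have s: "sum f D = 0"
      using D laurent_grading_subset by (subst (asm) finsum_laurent_ring) (blast | simp)+
    have single: "f d = Poly_Mapping.single d (Poly_Mapping.lookup (f d) d)" if "d \<in> D" for d
      using D(2) that by (auto simp: laurent_grading_def split: if_splits)
    show "\<forall>d\<in>D. f d = \<zero>\<^bsub>?L\<^esub>"
    proof
      fix d assume d: "d \<in> D"
      have "0 = (\<Sum>e\<in>D. Poly_Mapping.lookup (f e) d)"
        using s by (metis lookup_sum lookup_zero)
      also have "\<dots> = (\<Sum>e\<in>D. if e = d then Poly_Mapping.lookup (f d) d else 0)"
        by (rule sum.cong) (use single in \<open>auto, metis lookup_single_not_eq\<close>)
      also have "\<dots> = Poly_Mapping.lookup (f d) d" using D(1) d by simp
      finally show "f d = \<zero>\<^bsub>?L\<^esub>" using single[OF d] by simp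
    qed
  qed
qed

lemma matrix_ring_carrierD:
  assumes "A \<in> carrier (matrix_ring R n)"
  shows "A \<in> carrier_mat n n" "dim_row A = n" "dim_col A = n"
    and "\<lbrakk>i < n; j < n\<rbrakk> \<Longrightarrow> A $$ (i, j) \<in> carrier R"
  using assms by (auto simp: matrix_ring_def)

lemma (in abelian_monoid) finsum_exchange:
  assumes "finite A" "finite B" "\<And>i j. \<lbrakk>i \<in> A; j \<in> B\<rbrakk> \<Longrightarrow> f i j \<in> carrier G"
  shows "(\<Oplus>i\<in>A. \<Oplus>j\<in>B. f i j) = (\<Oplus>j\<in>B. \<Oplus>i\<in>A. f i j)"
  using assms(1,3)
proof (induction A rule: finite_induct)
  case empty
  then show ?case by simp
next
  case (insert a A)
  have "(\<Oplus>j\<in>B. \<Oplus>i\<in>insert a A. f i j) = (\<Oplus>j\<in>B. f a j \<oplus> (\<Oplus>i\<in>A. f i j))"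
    using insert by (intro finsum_cong') (auto simp: Pi_def)
  also have "\<dots> = (\<Oplus>j\<in>B. f a j) \<oplus> (\<Oplus>j\<in>B. \<Oplus>i\<in>A. f i j)"
    using insert by (intro finsum_addf) (auto simp: Pi_def)
  finally show ?case using insert by (auto simp: Pi_def)
qed

lemma ring_matrix_ring:
  fixes R (structure)
  assumes "ring R"
  shows "ring (matrix_ring R n)"
proof -
  interpret ring R by fact
  let ?M = "matrix_ring R n"
  note D = matrix_ring_carrierD
  have cl: "A $$ (i, k) \<otimes> B $$ (k, j) \<in> carrier R"
    if "A \<in> carrier ?M" "B \<in> carrier ?M" "i < n" "j < n" "k < n" for A B i j k
    using D(4)[OF that(1)] D(4)[OF that(2)] that(3-5) by simp
  have delta: "(\<Oplus>k\<in>{..<n}. if k = i then g k else \<zero>) = g i"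
    if "i < n" "g i \<in> carrier R" for g i
  proof -
    have "(\<Oplus>k\<in>{..<n}. if k = i then g k else \<zero>) = (\<Oplus>k\<in>{i}. g k)"
      using that by (intro add.finprod_mono_neutral_cong_right) auto
    then show ?thesis using that by simp
  qed
  show ?thesis
  proof (rule ringI)
    show "abelian_group ?M"
    proof (rule abelian_groupI)
      fix A assume A: "A \<in> carrier ?M"
      let ?B = "mat n n (\<lambda>(i, j). \<ominus> (A $$ (i, j)))"
      have "?B \<in> carrier ?M" using A by (auto simp: matrix_ring_def)
      moreover have "?B \<oplus>\<^bsub>?M\<^esub> A = \<zero>\<^bsub>?M\<^esub>"
        using A by (intro eq_matI) (auto simp: matrix_ring_def l_neg)
      ultimately show "\<exists>B \<in> carrier ?M. B \<oplus>\<^bsub>?M\<^esub> A = \<zero>\<^bsub>?M\<^esub>" by blast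
    qed (auto intro!: eq_matI simp: matrix_ring_def a_ac)
    show "monoid ?M"
    proof (rule monoidI)
      fix A B assume "A \<in> carrier ?M" "B \<in> carrier ?M"
      then show "A \<otimes>\<^bsub>?M\<^esub> B \<in> carrier ?M"
        by (auto simp: matrix_ring_def Pi_def)
    next
      show "\<one>\<^bsub>?M\<^esub> \<in> carrier ?M" by (auto simp: matrix_ring_def)
    next
      fix A B E assume A: "A \<in> carrier ?M" and B: "B \<in> carrier ?M" and E: "E \<in> carrier ?M"
      show "A \<otimes>\<^bsub>?M\<^esub> B \<otimes>\<^bsub>?M\<^esub> E = A \<otimes>\<^bsub>?M\<^esub> (B \<otimes>\<^bsub>?M\<^esub> E)"
      proof (rule eq_matI)
        fix i j assume "i < dim_row (A \<otimes>\<^bsub>?M\<^esub> (B \<otimes>\<^bsub>?M\<^esub> E))"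
          "j < dim_col (A \<otimes>\<^bsub>?M\<^esub> (B \<otimes>\<^bsub>?M\<^esub> E))"
        then have ij: "i < n" "j < n" by (auto simp: matrix_ring_def)
        have "(A \<otimes>\<^bsub>?M\<^esub> B \<otimes>\<^bsub>?M\<^esub> E) $$ (i, j)
            = (\<Oplus>k\<in>{..<n}. (\<Oplus>l\<in>{..<n}. A $$ (i, l) \<otimes> B $$ (l, k)) \<otimes> E $$ (k, j))"
          using ij D(4)[OF A] D(4)[OF B] D(4)[OF E]
          by (simp add: matrix_ring_def) (intro finsum_cong', auto simp: Pi_def)
        also have "\<dots> = (\<Oplus>k\<in>{..<n}. \<Oplus>l\<in>{..<n}. A $$ (i, l) \<otimes> (B $$ (l, k) \<otimes> E $$ (k, j)))"
          using ij D(4)[OF A] D(4)[OF B] D(4)[OF E]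
          by (intro finsum_cong' refl)
            (auto simp: finsum_ldistr Pi_def m_assoc intro!: finsum_cong')
        also have "\<dots> = (\<Oplus>l\<in>{..<n}. \<Oplus>k\<in>{..<n}. A $$ (i, l) \<otimes> (B $$ (l, k) \<otimes> E $$ (k, j)))"
          using ij D(4)[OF A] D(4)[OF B] D(4)[OF E] by (intro finsum_exchange) auto
        also have "\<dots> = (\<Oplus>l\<in>{..<n}. A $$ (i, l) \<otimes> (\<Oplus>k\<in>{..<n}. B $$ (l, k) \<otimes> E $$ (k, j)))"
          using ij D(4)[OF A] D(4)[OF B] D(4)[OF E]
          by (intro finsum_cong' refl) (auto simp: finsum_rdistr Pi_def)
        also have "\<dots> = (A \<otimes>\<^bsub>?M\<^esub> (B \<otimes>\<^bsub>?M\<^esub> E)) $$ (i, j)"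
          using ij D(4)[OF A] D(4)[OF B] D(4)[OF E]
          by (simp add: matrix_ring_def) (intro finsum_cong', auto simp: Pi_def)
        finally show "(A \<otimes>\<^bsub>?M\<^esub> B \<otimes>\<^bsub>?M\<^esub> E) $$ (i, j) = (A \<otimes>\<^bsub>?M\<^esub> (B \<otimes>\<^bsub>?M\<^esub> E)) $$ (i, j)" .
      qed (auto simp: matrix_ring_def)
    next
      fix A assume A: "A \<in> carrier ?M"
      show "\<one>\<^bsub>?M\<^esub> \<otimes>\<^bsub>?M\<^esub> A = A"
      proof (rule eq_matI)
        fix i j assume "i < dim_row A" "j < dim_col A"
        then have ij: "i < n" "j < n" using D[OF A] by auto
        have "(\<one>\<^bsub>?M\<^esub> \<otimes>\<^bsub>?M\<^esub> A) $$ (i, j) = (\<Oplus>k\<in>{..<n}. if k = i then A $$ (k, j) else \<zero>)"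
          using ij D(4)[OF A]
          by (simp add: matrix_ring_def) (intro finsum_cong', auto)
        then show "(\<one>\<^bsub>?M\<^esub> \<otimes>\<^bsub>?M\<^esub> A) $$ (i, j) = A $$ (i, j)"
          using delta[of i "\<lambda>k. A $$ (k, j)"] ij D(4)[OF A] by simp
      qed (use D[OF A] in \<open>auto simp: matrix_ring_def\<close>)
      show "A \<otimes>\<^bsub>?M\<^esub> \<one>\<^bsub>?M\<^esub> = A"
      proof (rule eq_matI)
        fix i j assume "i < dim_row A" "j < dim_col A"
        then have ij: "i < n" "j < n" using D[OF A] by auto
        have "(A \<otimes>\<^bsub>?M\<^esub> \<one>\<^bsub>?M\<^esub>) $$ (i, j) = (\<Oplus>k\<in>{..<n}. if k = j then A $$ (i, k) else \<zero>)"
          using ij D(4)[OF A]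
          by (simp add: matrix_ring_def) (intro finsum_cong', auto)
        then show "(A \<otimes>\<^bsub>?M\<^esub> \<one>\<^bsub>?M\<^esub>) $$ (i, j) = A $$ (i, j)"
          using delta[of j "\<lambda>k. A $$ (i, k)"] ij D(4)[OF A] by simp
      qed (use D[OF A] in \<open>auto simp: matrix_ring_def\<close>)
    qed
  next
    fix A B E assume A: "A \<in> carrier ?M" and B: "B \<in> carrier ?M" and E: "E \<in> carrier ?M"
    show "(A \<oplus>\<^bsub>?M\<^esub> B) \<otimes>\<^bsub>?M\<^esub> E = A \<otimes>\<^bsub>?M\<^esub> E \<oplus>\<^bsub>?M\<^esub> B \<otimes>\<^bsub>?M\<^esub> E"
    proof (rule eq_matI)
      fix i j assume "i < dim_row (A \<otimes>\<^bsub>?M\<^esub> E \<oplus>\<^bsub>?M\<^esub> B \<otimes>\<^bsub>?M\<^esub> E)"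
        "j < dim_col (A \<otimes>\<^bsub>?M\<^esub> E \<oplus>\<^bsub>?M\<^esub> B \<otimes>\<^bsub>?M\<^esub> E)"
      then have ij: "i < n" "j < n" by (auto simp: matrix_ring_def)
      have "((A \<oplus>\<^bsub>?M\<^esub> B) \<otimes>\<^bsub>?M\<^esub> E) $$ (i, j)
          = (\<Oplus>k\<in>{..<n}. A $$ (i, k) \<otimes> E $$ (k, j) \<oplus> B $$ (i, k) \<otimes> E $$ (k, j))"
        using ij D(4)[OF A] D(4)[OF B] D(4)[OF E]
        by (simp add: matrix_ring_def del: finsum_addf) (intro finsum_cong', auto simp: l_distr)
      also have "\<dots> = (A \<otimes>\<^bsub>?M\<^esub> E \<oplus>\<^bsub>?M\<^esub> B \<otimes>\<^bsub>?M\<^esub> E) $$ (i, j)"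
        using ij D(4)[OF A] D(4)[OF B] D(4)[OF E]
        by (subst finsum_addf) (auto simp: matrix_ring_def)
      finally show "((A \<oplus>\<^bsub>?M\<^esub> B) \<otimes>\<^bsub>?M\<^esub> E) $$ (i, j)
          = (A \<otimes>\<^bsub>?M\<^esub> E \<oplus>\<^bsub>?M\<^esub> B \<otimes>\<^bsub>?M\<^esub> E) $$ (i, j)" .
    qed (auto simp: matrix_ring_def)
    show "E \<otimes>\<^bsub>?M\<^esub> (A \<oplus>\<^bsub>?M\<^esub> B) = E \<otimes>\<^bsub>?M\<^esub> A \<oplus>\<^bsub>?M\<^esub> E \<otimes>\<^bsub>?M\<^esub> B"
    proof (rule eq_matI)
      fix i j assume "i < dim_row (E \<otimes>\<^bsub>?M\<^esub> A \<oplus>\<^bsub>?M\<^esub> E \<otimes>\<^bsub>?M\<^esub> B)"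
        "j < dim_col (E \<otimes>\<^bsub>?M\<^esub> A \<oplus>\<^bsub>?M\<^esub> E \<otimes>\<^bsub>?M\<^esub> B)"
      then have ij: "i < n" "j < n" by (auto simp: matrix_ring_def)
      have "(E \<otimes>\<^bsub>?M\<^esub> (A \<oplus>\<^bsub>?M\<^esub> B)) $$ (i, j)
          = (\<Oplus>k\<in>{..<n}. E $$ (i, k) \<otimes> A $$ (k, j) \<oplus> E $$ (i, k) \<otimes> B $$ (k, j))"
        using ij D(4)[OF A] D(4)[OF B] D(4)[OF E]
        by (simp add: matrix_ring_def del: finsum_addf) (intro finsum_cong', auto simp: r_distr)
      also have "\<dots> = (E \<otimes>\<^bsub>?M\<^esub> A \<oplus>\<^bsub>?M\<^esub> E \<otimes>\<^bsub>?M\<^esub> B) $$ (i, j)"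
        using ij D(4)[OF A] D(4)[OF B] D(4)[OF E]
        by (subst finsum_addf) (auto simp: matrix_ring_def)
      finally show "(E \<otimes>\<^bsub>?M\<^esub> (A \<oplus>\<^bsub>?M\<^esub> B)) $$ (i, j)
          = (E \<otimes>\<^bsub>?M\<^esub> A \<oplus>\<^bsub>?M\<^esub> E \<otimes>\<^bsub>?M\<^esub> B) $$ (i, j)" .
    qed (auto simp: matrix_ring_def)
  qed
qed

lemma finsum_matrix_ring:
  fixes R (structure)
  assumes "ring R" "finite S" "\<And>s. s \<in> S \<Longrightarrow> F s \<in> carrier (matrix_ring R n)"
  shows "finsum (matrix_ring R n) F S = mat n n (\<lambda>(i, j). \<Oplus>\<^bsub>R\<^esub>s\<in>S. F s $$ (i, j))"
proof -
  interpret ring R by fact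
  interpret M: ring "matrix_ring R n" by (rule ring_matrix_ring) fact
  show ?thesis
    using assms(2,3)
  proof (induction S rule: finite_induct)
    case empty
    show ?case by (simp only: M.finsum_empty finsum_empty) (auto simp: matrix_ring_def)
  next
    case (insert s S)
    have F: "F t $$ (i, j) \<in> carrier R" if "t \<in> insert s S" "i < n" "j < n" for t i j
      using insert.prems[OF that(1)] that(2,3) by (rule matrix_ring_carrierD)
    have "finsum (matrix_ring R n) F S = mat n n (\<lambda>(i, j). \<Oplus>\<^bsub>R\<^esub>s\<in>S. F s $$ (i, j))"
      using insert by blast
    then have "finsum (matrix_ring R n) F (insert s S)
        = F s \<oplus>\<^bsub>matrix_ring R n\<^esub> mat n n (\<lambda>(i, j). \<Oplus>\<^bsub>R\<^esub>s\<in>S. F s $$ (i, j))"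
      using insert.hyps insert.prems by (subst M.finsum_insert) auto
    also have "\<dots> = mat n n (\<lambda>(i, j). \<Oplus>\<^bsub>R\<^esub>s\<in>insert s S. F s $$ (i, j))"
      using insert(1,2) F by (auto simp: matrix_ring_def intro!: eq_matI)
    finally show ?case .
  qed
qed

lemma graded_ring_matrix:
  fixes R (structure)
  assumes "graded_ring R C"
  shows "graded_ring (matrix_ring R (length \<gamma>)) (matrix_grading C \<gamma>)"
proof -
  interpret graded_ring R C by fact
  define n where "n = length \<gamma>"
  let ?M = "matrix_ring R n"
  interpret M: ring ?M by (rule ring_matrix_ring) (rule ring_axioms)
  have sub: "C d \<subseteq> carrier R" for d
    by (rule additive_subgroup.a_subset[OF component_subgroup])
  have zero: "\<zero> \<in> C d" for d
    by (rule additive_subgroup.zero_closed[OF component_subgroup])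
  have plus: "x \<oplus> y \<in> C d" if "x \<in> C d" "y \<in> C d" for x y d
    using additive_subgroup.a_closed[OF component_subgroup that] .
  have uminus: "\<ominus> x \<in> C d" if "x \<in> C d" for x d
    using additive_subgroup.a_inv_closed[OF component_subgroup that] .
  have fsum: "(\<Oplus>s\<in>S. f s) \<in> C d" if "finite S" "\<And>s. s \<in> S \<Longrightarrow> f s \<in> C d"
    for f and S :: "nat set" and d
    using that
  proof (induction S rule: finite_induct)
    case (insert s S)
    then have "f s \<in> C d" "(\<Oplus>s\<in>S. f s) \<in> C d" "f s \<in> carrier R" "f \<in> S \<rightarrow> carrier R"
      using sub by blast+
    then show ?case using insert.hyps plus by simp
  qed (simp add: zero)
  have msub: "matrix_grading C \<gamma> d \<subseteq> carrier ?M" for d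
    using sub by (auto simp: matrix_grading_def matrix_ring_def n_def subset_iff)
  have reindex: "(\<Oplus>\<delta>\<in>S. f (- g + \<delta> + h)) = (\<Oplus>d\<in>(\<lambda>\<delta>. - g + \<delta> + h) ` S. f d)"
    if "\<And>d. d \<in> (\<lambda>\<delta>. - g + \<delta> + h) ` S \<Longrightarrow> f d \<in> carrier R" for f S and g h :: int
    using that by (subst finsum_reindex) (auto simp: inj_on_def)
  have "graded_ring ?M (matrix_grading C \<gamma>)"
  proof (intro graded_ring.intro graded_ring_axioms.intro)
    show "ring ?M" ..
  next
    fix d
    show "additive_subgroup (matrix_grading C \<gamma> d) ?M"
    proof (intro additive_subgroupI M.add.subgroupI)
      show "matrix_grading C \<gamma> d \<subseteq> carrier ?M" using msub by simp
      have "\<zero>\<^bsub>?M\<^esub> \<in> matrix_grading C \<gamma> d"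
        using zero by (auto simp: matrix_grading_def matrix_ring_def n_def)
      then show "matrix_grading C \<gamma> d \<noteq> {}" by blast
    next
      fix A assume A: "A \<in> matrix_grading C \<gamma> d"
      let ?B = "mat n n (\<lambda>(i, j). \<ominus> (A $$ (i, j)))"
      have Ac: "A \<in> carrier ?M" using A msub by blast
      have B: "?B \<in> matrix_grading C \<gamma> d"
        using A uminus by (auto simp: matrix_grading_def n_def)
      have "\<ominus>\<^bsub>?M\<^esub> A = ?B"
      proof (rule M.minus_equality)
        show "?B \<oplus>\<^bsub>?M\<^esub> A = \<zero>\<^bsub>?M\<^esub>"
          using Ac by (intro eq_matI) (auto simp: matrix_ring_def l_neg)
      qed (use Ac B msub in blast)+
      then show "\<ominus>\<^bsub>?M\<^esub> A \<in> matrix_grading C \<gamma> d" using B by simp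
    next
      fix A B assume "A \<in> matrix_grading C \<gamma> d" "B \<in> matrix_grading C \<gamma> d"
      then show "A \<oplus>\<^bsub>?M\<^esub> B \<in> matrix_grading C \<gamma> d"
        using plus by (auto simp: matrix_grading_def matrix_ring_def n_def)
    qed
  next
    fix A B d e
    assume A: "A \<in> matrix_grading C \<gamma> d" and B: "B \<in> matrix_grading C \<gamma> e"
    have "A $$ (i, k) \<otimes> B $$ (k, j) \<in> C (- (\<gamma> ! i) + (d + e) + \<gamma> ! j)"
      if "i < n" "j < n" "k < n" for i j k
      using component_mult[of "A $$ (i, k)" "- (\<gamma> ! i) + d + \<gamma> ! k"
          "B $$ (k, j)" "- (\<gamma> ! k) + e + \<gamma> ! j"] A B that
      by (auto simp: matrix_grading_def n_def algebra_simps)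
    then show "A \<otimes>\<^bsub>?M\<^esub> B \<in> matrix_grading C \<gamma> (d + e)"
      unfolding matrix_grading_def matrix_ring_def
      by (auto simp: n_def[symmetric] intro!: fsum)
  next
    fix A assume A: "A \<in> carrier ?M"
    have "\<exists>D f. finite D \<and> (\<forall>d\<in>D. f d \<in> C d) \<and> A $$ (i, j) = (\<Oplus>d\<in>D. f d)"
      if "i < n" "j < n" for i j
      using components_span matrix_ring_carrierD(4)[OF A that] by blast
    then obtain D f where Df: "\<And>i j. \<lbrakk>i < n; j < n\<rbrakk> \<Longrightarrow>
        finite (D i j) \<and> (\<forall>d\<in>D i j. f i j d \<in> C d) \<and> A $$ (i, j) = (\<Oplus>d\<in>D i j. f i j d)"
      by metis
    define g where "g i j d = (if d \<in> D i j then f i j d else \<zero>)" for i j d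
    have g: "g i j d \<in> C d" if "i < n" "j < n" for i j d
      using Df[OF that] zero by (auto simp: g_def)
    define S where "S = (\<Union>i<n. \<Union>j<n. (\<lambda>d. \<gamma> ! i + d - \<gamma> ! j) ` D i j)"
    define F where "F \<delta> = mat n n (\<lambda>(i, j). g i j (- (\<gamma> ! i) + \<delta> + \<gamma> ! j))" for \<delta>
    have S: "finite S" using Df by (auto simp: S_def)
    have F: "F \<delta> \<in> matrix_grading C \<gamma> \<delta>" for \<delta>
      using g by (auto simp: F_def matrix_grading_def n_def)
    have "A = finsum ?M F S"
    proof (subst finsum_matrix_ring[OF ring_axioms S])
      show "F s \<in> carrier ?M" for s using F msub by blast
      show "A = mat n n (\<lambda>(i, j). \<Oplus>s\<in>S. F s $$ (i, j))"
      proof (rule eq_matI)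
        fix i j assume "i < dim_row (mat n n (\<lambda>(i, j). \<Oplus>s\<in>S. F s $$ (i, j)))"
          "j < dim_col (mat n n (\<lambda>(i, j). \<Oplus>s\<in>S. F s $$ (i, j)))"
        then have ij: "i < n" "j < n" by auto
        let ?T = "(\<lambda>\<delta>. - (\<gamma> ! i) + \<delta> + \<gamma> ! j) ` S"
        have DT: "D i j \<subseteq> ?T"
        proof
          fix d assume "d \<in> D i j"
          then have "\<gamma> ! i + d - \<gamma> ! j \<in> S" using ij by (auto simp: S_def)
          then show "d \<in> ?T" by (rule rev_image_eqI) simp
        qed
        have gc: "g i j d \<in> carrier R" for d using g[OF ij] sub by blast
        have "(\<Oplus>s\<in>S. F s $$ (i, j)) = (\<Oplus>s\<in>S. g i j (- (\<gamma> ! i) + s + \<gamma> ! j))"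
          using ij gc by (intro finsum_cong') (auto simp: F_def)
        also have "\<dots> = (\<Oplus>d\<in>?T. g i j d)" by (rule reindex) (rule gc)
        also have "\<dots> = (\<Oplus>d\<in>D i j. f i j d)"
          using S DT gc by (intro add.finprod_mono_neutral_cong_right) (auto simp: g_def)
        also have "\<dots> = A $$ (i, j)" using Df[OF ij] by simp
        finally show "A $$ (i, j) = mat n n (\<lambda>(i, j). \<Oplus>s\<in>S. F s $$ (i, j)) $$ (i, j)"
          using ij by simp
      qed (use matrix_ring_carrierD[OF A] in auto)
    qed
    then show "\<exists>D f. finite D \<and> (\<forall>d\<in>D. f d \<in> matrix_grading C \<gamma> d) \<and> A = (\<Oplus>\<^bsub>?M\<^esub>d\<in>D. f d)"
      using S F by blast
  next
    fix S and F :: "int \<Rightarrow> 'a mat"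
    assume S: "finite S" and F: "\<forall>d\<in>S. F d \<in> matrix_grading C \<gamma> d"
      and z: "(\<Oplus>\<^bsub>?M\<^esub>d\<in>S. F d) = \<zero>\<^bsub>?M\<^esub>"
    have Fc: "F s \<in> carrier ?M" if "s \<in> S" for s using F msub that by blast
    have entry: "F \<delta> $$ (i, j) = \<zero>" if d: "\<delta> \<in> S" and ij: "i < n" "j < n" for \<delta> i j
    proof -
      let ?T = "(\<lambda>\<delta>. - (\<gamma> ! i) + \<delta> + \<gamma> ! j) ` S"
      let ?h = "\<lambda>d. F (\<gamma> ! i + d - \<gamma> ! j) $$ (i, j)"
      have h: "\<forall>d\<in>?T. ?h d \<in> C d"
        using F ij by (auto simp: matrix_grading_def n_def)
      have "\<zero> = (\<Oplus>s\<in>S. F s $$ (i, j))"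
        using arg_cong[OF trans[OF finsum_matrix_ring[OF ring_axioms S Fc, symmetric] z], of "\<lambda>A. A $$ (i, j)"] ij
        by (simp add: matrix_ring_def)
      also have "\<dots> = (\<Oplus>s\<in>S. ?h (- (\<gamma> ! i) + s + \<gamma> ! j))"
        by simp
      also have "\<dots> = (\<Oplus>d\<in>?T. ?h d)"
        by (rule reindex) (use h sub in blast)
      finally have "(\<Oplus>d\<in>?T. ?h d) = \<zero>" by (rule sym)
      then have "\<forall>d\<in>?T. ?h d = \<zero>"
        by (rule components_independent[OF finite_imageI[OF S] h])
      then have "?h (- (\<gamma> ! i) + \<delta> + \<gamma> ! j) = \<zero>" using d by blast
      then show ?thesis by simp
    qed
    show "\<forall>d\<in>S. F d = \<zero>\<^bsub>?M\<^esub>"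
    proof
      fix d assume d: "d \<in> S"
      show "F d = \<zero>\<^bsub>?M\<^esub>"
        using entry[OF d] matrix_ring_carrierD(2,3)[OF Fc[OF d]]
        by (intro eq_matI) (auto simp: matrix_ring_def)
    qed
  qed
  then show ?thesis by (simp add: n_def)
qed

end

theory Submission
  imports Defs
begin

text \<open>
  Both rings are graded by monomials in the degrees divisible by \<open>m\<close>, where \<open>m = 0\<close> for the trivial
  grading. In both cases graded unit-regularity means that the multiset of the \<open>\<gamma>\<^sub>i\<close> modulo \<open>m\<close> is
  invariant under translation by each difference \<open>\<gamma>\<^sub>p - \<gamma>\<^sub>q\<close>.

  For necessity, apply graded unit-regularity to a matrix unit. This gives an invertible homogeneous
  matrix whose degree is determined modulo \<open>m\<close>. Some term of the Leibniz formula for its determinant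
  is nonzero, and the permutation of that term matches the multiset with its translate. For
  sufficiency, stripping off the monomials turns a homogeneous matrix of degree \<open>\<delta>\<close> into a matrix over
  the field, supported on blocks indexed by residues. Translation invariance makes these blocks
  square, and Gaussian elimination inside them yields the required unit.

  For \<open>m = 0\<close>, comparing sums shows that only translation by zero preserves the multiset; for \<open>m > 0\<close>
  with all residues present, invariance means equal multiplicities.
\<close>

section \<open>Gaussian elimination within blocks over a field\<close>

text \<open>
  The functions \<open>c\<close> and \<open>d\<close> record the degrees of rows and columns modulo the period of the grading,
  so a homogeneous matrix has nonzero entries only where they agree.
\<close>

lemma block_matrix_unit_regular:
  fixes a :: "'i \<Rightarrow> 'j \<Rightarrow> 'a::field"
  assumes "finite I" "finite J" "image_mset c (mset_set I) = image_mset d (mset_set J)"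
    and "\<forall>i\<in>I. \<forall>j\<in>J. a i j \<noteq> 0 \<longrightarrow> c i = d j"
  shows "\<exists>u g. (\<forall>i\<in>I. \<forall>j\<in>J. u j i \<noteq> 0 \<longrightarrow> c i = d j) \<and> (\<forall>i\<in>I. \<forall>j\<in>J. g i j \<noteq> 0 \<longrightarrow> c i = d j) \<and>
    (\<forall>j\<in>J. \<forall>j'\<in>J. (\<Sum>i\<in>I. u j i * g i j') = (if j = j' then 1 else 0)) \<and>
    (\<forall>i\<in>I. \<forall>i'\<in>I. (\<Sum>j\<in>J. g i j * u j i') = (if i = i' then 1 else 0)) \<and>
    (\<forall>i\<in>I. \<forall>j\<in>J. (\<Sum>k\<in>J. a i k * (\<Sum>l\<in>I. u k l * a l j)) = a i j)"
  using assms
proof (induction "card I" arbitrary: I J a)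
  case 0
  then have "I = {}" by simp
  moreover from this have "J = {}" using 0 by (auto simp: mset_set_empty_iff)
  ultimately show ?case by simp
next
  case (Suc N)
  note fin = Suc.prems(1,2)
  have compat: "c i = d j" if "i \<in> I" "j \<in> J" "a i j \<noteq> 0" for i j
    using Suc.prems(4) that by blast
  have "I \<noteq> {}" using Suc.hyps(2) by auto
  \<comment> \<open>A nonzero entry lies in a block by compatibility and can serve as pivot. If
    there is none, equality of the multisets still pairs any row with a column of the same block. As
    \<open>c p = d q\<close>, deleting the pair preserves that equality.\<close>
  have "\<exists>p\<in>I. \<exists>q\<in>J. c p = d q \<and> (a p q \<noteq> 0 \<or> (\<forall>i\<in>I. \<forall>j\<in>J. a i j = 0))"
  proof (cases "\<forall>i\<in>I. \<forall>j\<in>J. a i j = 0")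
    case True
    from \<open>I \<noteq> {}\<close> obtain p where p: "p \<in> I" by blast
    then have "c p \<in># image_mset d (mset_set J)"
      using fin unfolding Suc.prems(3)[symmetric] by auto
    then show ?thesis using p fin True by auto
  next
    case False
    then show ?thesis using compat by blast
  qed
  then obtain p q where p: "p \<in> I" and q: "q \<in> J" and cd: "c p = d q"
    and pivot: "a p q \<noteq> 0 \<or> (\<forall>i\<in>I. \<forall>j\<in>J. a i j = 0)" by blast
  define I' J' where "I' = I - {p}" and "J' = J - {q}"
  have I: "I = insert p I'" "p \<notin> I'" "finite I'" and J: "J = insert q J'" "q \<notin> J'" "finite J'"
    using p q fin by (auto simp: I'_def J'_def)
  text \<open>
    Eliminate with the pivot \<open>a p q\<close>: \<open>a'\<close> is its Schur complement, \<open>u'\<close> and \<open>g' = u'\<^sup>-\<^sup>1\<close> come from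
    the induction hypothesis. If \<open>a = 0\<close>, the same formulas with \<open>\<alpha> = 1\<close> still give an inverse pair.
  \<close>
  define \<alpha> where "\<alpha> = (if a p q = 0 then 1 else a p q)"
  have \<alpha>: "\<alpha> \<noteq> 0" by (simp add: \<alpha>_def)
  define r s where "r j = a p j" and "s i = a i q" for i j
  define a' where "a' i j = a i j - s i * r j / \<alpha>" for i j
  \<comment> \<open>The pivot row and column are supported in the pivot's block, so the correction
    \<open>s i * r j / \<alpha>\<close> leaves no block and \<open>a'\<close> satisfies the
    induction hypothesis.\<close>
  have r: "d j = c p" if "j \<in> J'" "r j \<noteq> 0" for j
    using compat[of p j] that p by (auto simp: r_def J)
  have s: "c i = c p" if "i \<in> I'" "s i \<noteq> 0" for i
    using compat[of i q] that q cd by (auto simp: s_def I)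
  have a': "c i = d j" if "i \<in> I'" "j \<in> J'" "a' i j \<noteq> 0" for i j
    using compat[of i j] r[of j] s[of i] that by (cases "a i j = 0") (auto simp: a'_def I J)
  have "image_mset c (mset_set I') = image_mset d (mset_set J')"
    using Suc.prems(3) I J cd by simp
  moreover have "N = card I'" using Suc.hyps(2) I by simp
  moreover have "\<forall>i\<in>I'. \<forall>j\<in>J'. a' i j \<noteq> 0 \<longrightarrow> c i = d j" using a' by blast
  ultimately obtain u' g' where *:
      "\<forall>i\<in>I'. \<forall>j\<in>J'. u' j i \<noteq> 0 \<longrightarrow> c i = d j" "\<forall>i\<in>I'. \<forall>j\<in>J'. g' i j \<noteq> 0 \<longrightarrow> c i = d j"
      "\<forall>j\<in>J'. \<forall>k\<in>J'. (\<Sum>i\<in>I'. u' j i * g' i k) = (if j = k then 1 else 0)"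
      "\<forall>i\<in>I'. \<forall>k\<in>I'. (\<Sum>j\<in>J'. g' i j * u' j k) = (if i = k then 1 else 0)"
      "\<forall>i\<in>I'. \<forall>j\<in>J'. (\<Sum>k\<in>J'. a' i k * (\<Sum>l\<in>I'. u' k l * a' l j)) = a' i j"
    using Suc.hyps(1)[of I' J' a'] I(3) J(3) by (elim meta_impE exE conjE) assumption+
  have u': "c i = d j" if "i \<in> I'" "j \<in> J'" "u' j i \<noteq> 0" for i j
    using *(1) that by blast
  have g': "c i = d j" if "i \<in> I'" "j \<in> J'" "g' i j \<noteq> 0" for i j
    using *(2) that by blast
  note ug' = *(3)[rule_format] and gu' = *(4)[rule_format] and aua' = *(5)[rule_format]
  \<comment> \<open>In matrix notation, these are the row \<open>r u'\<close> and the column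
    \<open>u' s\<close>; \<open>t\<close> is the scalar \<open>r u' s\<close>.\<close>
  define ru us where "ru i = (\<Sum>j\<in>J'. r j * u' j i)" and "us j = (\<Sum>i\<in>I'. u' j i * s i)" for i j
  define t where "t = (\<Sum>i\<in>I'. ru i * s i)"
  have t: "(\<Sum>j\<in>J'. r j * us j) = t"
    unfolding t_def us_def ru_def sum_distrib_left sum_distrib_right
    by (subst sum.swap) (simp add: mult.assoc)
  have rug: "(\<Sum>i\<in>I'. ru i * g' i j) = r j" if "j \<in> J'" for j
  proof -
    have "(\<Sum>i\<in>I'. ru i * g' i j) = (\<Sum>k\<in>J'. r k * (\<Sum>i\<in>I'. u' k i * g' i j))"
      unfolding ru_def sum_distrib_left sum_distrib_right
      by (subst sum.swap) (simp add: mult.assoc)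
    also have "\<dots> = (\<Sum>k\<in>J'. if k = j then r j else 0)"
      using that by (intro sum.cong) (auto simp: ug')
    finally show ?thesis using that J(3) by simp
  qed
  have gus: "(\<Sum>j\<in>J'. g' i j * us j) = s i" if "i \<in> I'" for i
  proof -
    have "(\<Sum>j\<in>J'. g' i j * us j) = (\<Sum>k\<in>I'. (\<Sum>j\<in>J'. g' i j * u' j k) * s k)"
      unfolding us_def sum_distrib_left sum_distrib_right
      by (subst sum.swap) (simp add: mult.assoc)
    also have "\<dots> = (\<Sum>k\<in>I'. if k = i then s i else 0)"
      using that by (intro sum.cong) (auto simp: gu')
    finally show ?thesis using that I(3) by simp
  qed
  \<comment> \<open>With the pivot placed first, \<open>g = L diag(\<alpha>, g') R\<close>, where
    \<open>L\<close> is unit lower triangular with column \<open>s / \<alpha>\<close> and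
    \<open>R\<close> is unit upper triangular with row \<open>r / \<alpha>\<close>. Multiplying the
    inverse factors in reverse order gives \<open>u\<close>; its corner picks up the term
    \<open>t / \<alpha>\<^sup>2\<close>.\<close>
  define u where "u j i = (if j = q then if i = p then 1 / \<alpha> + t / \<alpha>\<^sup>2 else - ru i / \<alpha>
      else if i = p then - us j / \<alpha> else u' j i)" for j i
  define g where "g i j = (if i = p then if j = q then \<alpha> else r j
      else if j = q then s i else s i * r j / \<alpha> + g' i j)" for i j
  have u_simps: "u q p = 1 / \<alpha> + t / \<alpha>\<^sup>2" "\<And>i. i \<in> I' \<Longrightarrow> u q i = - ru i / \<alpha>"
      "\<And>j. j \<in> J' \<Longrightarrow> u j p = - us j / \<alpha>" "\<And>i j. \<lbrakk>i \<in> I'; j \<in> J'\<rbrakk> \<Longrightarrow> u j i = u' j i"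
    and g_simps: "g p q = \<alpha>" "\<And>j. j \<in> J' \<Longrightarrow> g p j = r j" "\<And>i. i \<in> I' \<Longrightarrow> g i q = s i"
      "\<And>i j. \<lbrakk>i \<in> I'; j \<in> J'\<rbrakk> \<Longrightarrow> g i j = s i * r j / \<alpha> + g' i j"
    using I(2) J(2) by (auto simp: u_def g_def)
  have u: "c i = d j" if "i \<in> I" "j \<in> J" "u j i \<noteq> 0" for i j
  proof -
    have ru: "c i = c p" if i: "i \<in> I'" and "ru i \<noteq> 0" for i
    proof -
      obtain j where "j \<in> J'" "r j * u' j i \<noteq> 0"
        using \<open>ru i \<noteq> 0\<close> unfolding ru_def by (meson sum.neutral)
      then show ?thesis using r[of j] u'[OF i, of j] by simp
    qed
    have us: "d j = c p" if j: "j \<in> J'" and "us j \<noteq> 0" for j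
    proof -
      obtain i where "i \<in> I'" "u' j i * s i \<noteq> 0"
        using \<open>us j \<noteq> 0\<close> unfolding us_def by (meson sum.neutral)
      then show ?thesis using s[of i] u'[OF _ j, of i] by simp
    qed
    show ?thesis
      using that cd ru us u' by (cases "i = p"; cases "j = q") (auto simp: u_simps I J)
  qed
  have g: "c i = d j" if "i \<in> I" "j \<in> J" "g i j \<noteq> 0" for i j
    using that cd r s g'
    by (cases "i = p"; cases "j = q"; cases "g' i j = 0") (auto simp: g_simps I J)
  have ug: "(\<Sum>i\<in>I. u j i * g i k) = (if j = k then 1 else 0)" if jk: "j \<in> J" "k \<in> J" for j k
  proof -
    \<comment> \<open>The facts 1 to 4 are the blocks of the product: corner, rest of the pivot row,
      rest of the pivot column, remainder. In the corner, \<open>t\<close> cancels against the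
      correction in \<open>u q p\<close>.\<close>
    have "(\<Sum>i\<in>I'. u q i * g i q) = - t / \<alpha>"
      using \<alpha> by (simp add: u_simps g_simps t_def sum_divide_distrib sum_negf)
    then have 1: "(\<Sum>i\<in>I. u q i * g i q) = 1"
      using I \<alpha> by (simp add: u_simps g_simps field_simps power2_eq_square)
    have 2: "(\<Sum>i\<in>I. u q i * g i k) = 0" if "k \<in> J'" for k
    proof -
      have "(\<Sum>i\<in>I'. u q i * g i k) = (\<Sum>i\<in>I'. - (r k / \<alpha>\<^sup>2) * (ru i * s i) - (ru i * g' i k) / \<alpha>)"
        using that \<alpha> by (intro sum.cong) (simp_all add: u_simps g_simps field_simps power2_eq_square)
      also have "\<dots> = - (r k / \<alpha>\<^sup>2) * t - r k / \<alpha>"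
        using that by (simp add: sum_subtractf sum_distrib_left[symmetric] sum_divide_distrib[symmetric]
            rug t_def sum_negf)
      finally have "(\<Sum>i\<in>I. u q i * g i k) = u q p * g p k + (- (r k / \<alpha>\<^sup>2) * t - r k / \<alpha>)"
        using I by simp
      then show ?thesis
        using \<alpha> that by (simp add: u_simps g_simps field_simps power2_eq_square)
    qed
    have 3: "(\<Sum>i\<in>I. u j i * g i q) = 0" if "j \<in> J'" for j
      using that I \<alpha> by (simp add: u_simps g_simps us_def)
    have 4: "(\<Sum>i\<in>I. u j i * g i k) = (if j = k then 1 else 0)" if "j \<in> J'" "k \<in> J'" for j k
    proof -
      have "(\<Sum>i\<in>I'. u j i * g i k) = (\<Sum>i\<in>I'. (u' j i * s i) * (r k / \<alpha>) + u' j i * g' i k)"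
        using that by (intro sum.cong) (simp_all add: u_simps g_simps field_simps)
      also have "\<dots> = us j * (r k / \<alpha>) + (if j = k then 1 else 0)"
        using that by (simp add: sum.distrib sum_distrib_right[symmetric] sum_divide_distrib[symmetric] us_def ug')
      finally show ?thesis using I that by (simp add: u_simps g_simps)
    qed
    show ?thesis using jk 1 2 3 4 J(2) unfolding J(1) by auto
  qed
  have gu: "(\<Sum>j\<in>J. g i j * u j k) = (if i = k then 1 else 0)" if ik: "i \<in> I" "k \<in> I" for i k
  proof -
    have "(\<Sum>j\<in>J'. g p j * u j p) = - t / \<alpha>"
      using \<alpha> by (simp add: u_simps g_simps t[symmetric] sum_divide_distrib sum_negf)
    then have 1: "(\<Sum>j\<in>J. g p j * u j p) = 1"
      using J \<alpha> by (simp add: u_simps g_simps field_simps power2_eq_square)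
    have 2: "(\<Sum>j\<in>J. g i j * u j p) = 0" if "i \<in> I'" for i
    proof -
      have "(\<Sum>j\<in>J'. g i j * u j p) = (\<Sum>j\<in>J'. - (s i / \<alpha>\<^sup>2) * (r j * us j) - (g' i j * us j) / \<alpha>)"
        using that \<alpha> by (intro sum.cong) (simp_all add: u_simps g_simps field_simps power2_eq_square)
      also have "\<dots> = - (s i / \<alpha>\<^sup>2) * t - s i / \<alpha>"
        using that by (simp add: sum_subtractf sum_distrib_left[symmetric] sum_divide_distrib[symmetric]
            gus t sum_negf)
      finally have "(\<Sum>j\<in>J. g i j * u j p) = g i q * u q p + (- (s i / \<alpha>\<^sup>2) * t - s i / \<alpha>)"
        using J by simp
      then show ?thesis
        using \<alpha> that by (simp add: u_simps g_simps field_simps power2_eq_square)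
    qed
    have 3: "(\<Sum>j\<in>J. g p j * u j k) = 0" if "k \<in> I'" for k
      using that J \<alpha> by (simp add: u_simps g_simps ru_def)
    have 4: "(\<Sum>j\<in>J. g i j * u j k) = (if i = k then 1 else 0)" if "i \<in> I'" "k \<in> I'" for i k
    proof -
      have "(\<Sum>j\<in>J'. g i j * u j k) = (\<Sum>j\<in>J'. (s i / \<alpha>) * (r j * u' j k) + g' i j * u' j k)"
        using that by (intro sum.cong) (simp_all add: u_simps g_simps field_simps)
      also have "\<dots> = (s i / \<alpha>) * ru k + (if i = k then 1 else 0)"
        using that by (simp add: sum.distrib sum_distrib_left[symmetric] sum_divide_distrib[symmetric] ru_def gu')
      finally show ?thesis using J that by (simp add: u_simps g_simps)
    qed
    show ?thesis using ik 1 2 3 4 I(2) unfolding I(1) by auto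
  qed
  \<comment> \<open>If \<open>a\<close> is nonzero, then \<open>a = L diag(\<alpha>, a') R\<close>
    with the same \<open>L\<close> and \<open>R\<close> as for \<open>g\<close>. Hence
    \<open>a u a = L diag(\<alpha>, a' u' a') R\<close>, and \<open>a' u' a' = a'\<close> by
    induction.\<close>
  have aua: "(\<Sum>k\<in>J. a i k * (\<Sum>l\<in>I. u k l * a l j)) = a i j" if ij: "i \<in> I" "j \<in> J" for i j
  proof (cases "\<forall>i\<in>I. \<forall>j\<in>J. a i j = 0")
    case True
    then show ?thesis using ij by simp
  next
    case False
    then have "a p q = \<alpha>" using pivot by (auto simp: \<alpha>_def)
    then have a_simps: "a p q = \<alpha>" "\<And>j. a p j = r j" "\<And>i. a i q = s i"
      "\<And>i j. a i j = a' i j + s i * r j / \<alpha>" by (simp_all add: a'_def r_def s_def)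
    have s_p: "s p = \<alpha>" using a_simps(1) by (simp add: s_def)
    \<comment> \<open>Here \<open>v = u' a'\<close> and \<open>w = r u' a'\<close>. The facts
      \<open>ua1\<close> to \<open>ua4\<close> compute \<open>u a\<close>: its pivot row is 1
      followed by \<open>(r - w) / \<alpha>\<close>, its pivot column is 0 below that, and the rest
      is \<open>v\<close>.\<close>
    define v where "v k j = (\<Sum>l\<in>I'. u' k l * a' l j)" for k j
    define w where "w j = (\<Sum>l\<in>I'. ru l * a' l j)" for j
    have rv: "(\<Sum>k\<in>J'. r k * v k j) = w j" for j
      unfolding w_def v_def ru_def sum_distrib_left sum_distrib_right
      by (subst sum.swap) (simp add: mult.assoc)
    have "(\<Sum>l\<in>I'. u q l * a l q) = - t / \<alpha>"
      using \<alpha> by (simp add: u_simps a_simps(3) t_def sum_divide_distrib sum_negf)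
    then have ua1: "(\<Sum>l\<in>I. u q l * a l q) = 1"
      using I \<alpha> by (simp add: u_simps a_simps(1) field_simps power2_eq_square)
    have ua2: "(\<Sum>l\<in>I. u q l * a l j) = (r j - w j) / \<alpha>" for j
    proof -
      have "(\<Sum>l\<in>I'. u q l * a l j) = (\<Sum>l\<in>I'. - (r j / \<alpha>\<^sup>2) * (ru l * s l) - (ru l * a' l j) / \<alpha>)"
        using \<alpha> by (intro sum.cong) (simp_all add: u_simps a_simps(4) field_simps power2_eq_square)
      also have "\<dots> = - (r j / \<alpha>\<^sup>2) * t - w j / \<alpha>"
        by (simp add: sum_subtractf sum_distrib_left[symmetric] sum_divide_distrib[symmetric]
            w_def t_def sum_negf)
      finally have "(\<Sum>l\<in>I. u q l * a l j) = u q p * a p j + (- (r j / \<alpha>\<^sup>2) * t - w j / \<alpha>)"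
        using I by simp
      also have "\<dots> = (r j - w j) / \<alpha>"
        using \<alpha> by (simp add: u_simps a_simps(2) field_simps power2_eq_square)
      finally show ?thesis .
    qed
    have ua3: "(\<Sum>l\<in>I. u k l * a l q) = 0" if "k \<in> J'" for k
      using that I \<alpha> s_p by (simp add: u_simps a_simps(3) us_def)
    have ua4: "(\<Sum>l\<in>I. u k l * a l j) = v k j" if "k \<in> J'" for j k
    proof -
      have "(\<Sum>l\<in>I'. u k l * a l j) = (\<Sum>l\<in>I'. (u' k l * s l) * (r j / \<alpha>) + u' k l * a' l j)"
        using that by (intro sum.cong) (simp_all add: u_simps a_simps(4) field_simps)
      also have "\<dots> = us k * (r j / \<alpha>) + v k j"
        by (simp add: sum.distrib sum_distrib_right[symmetric] sum_divide_distrib[symmetric] us_def v_def)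
      finally show ?thesis using I that by (simp add: u_simps a_simps(2))
    qed
    show ?thesis
    proof (cases "j = q")
      case True
      then show ?thesis using J by (simp add: ua1 ua3)
    next
      case False
      then have j: "j \<in> J'" using ij by (simp add: J)
      have *: "(\<Sum>k\<in>J. a i k * (\<Sum>l\<in>I. u k l * a l j)) = s i * (r j - w j) / \<alpha> + (\<Sum>k\<in>J'. a i k * v k j)"
        using J by (simp add: ua2 ua4 a_simps(3))
      show ?thesis
      proof (cases "i = p")
        case True
        then show ?thesis unfolding * using \<alpha> s_p by (simp add: a_simps(2) rv)
      next
        case False
        then have i: "i \<in> I'" using ij by (simp add: I)
        have "(\<Sum>k\<in>J'. a i k * v k j) = (\<Sum>k\<in>J'. a' i k * v k j + (s i / \<alpha>) * (r k * v k j))"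
          by (intro sum.cong) (simp_all add: a_simps(4) field_simps)
        also have "\<dots> = a' i j + (s i / \<alpha>) * w j"
          using aua'[OF i j] by (simp add: sum.distrib sum_distrib_left[symmetric] sum_divide_distrib[symmetric] rv v_def[symmetric])
        finally show ?thesis unfolding * using \<alpha> by (simp add: a'_def field_simps)
      qed
    qed
  qed
  show ?case using u g ug gu aua by blast
qed

section \<open>Transversals and indexed multisets\<close>

text \<open>Every term of the Leibniz formula has a zero factor. Used contrapositively, to extract
  from a nonzero determinant a permutation along which all entries are nonzero.\<close>

lemma det_eq_0_if_no_transversal:
  fixes U :: "'a::comm_ring_1 mat"
  assumes "U \<in> carrier_mat n n" "\<And>\<pi>. \<pi> permutes {..<n} \<Longrightarrow> \<exists>i<n. U $$ (i, \<pi> i) = 0"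
  shows "det U = 0"
proof -
  have "(\<Prod>i = 0..<n. U $$ (i, \<pi> i)) = 0" if "\<pi> permutes {0..<n}" for \<pi>
    using assms(2)[of \<pi>] that by (intro prod_zero) (auto simp: atLeast0LessThan)
  then show ?thesis unfolding det_def'[OF assms(1)] by (intro sum.neutral) auto
qed

text \<open>Moves from lists to index sets, where permutations act and the block lemma is
  stated.\<close>

lemma mset_map_nth: "mset (map f xs) = image_mset (\<lambda>i. f (xs ! i)) (mset_set {..<length xs})"
proof -
  have "mset (map f xs) = image_mset f (mset (map ((!) xs) [0..<length xs]))"
    by (simp add: map_nth)
  then show ?thesis by (simp add: multiset.map_comp o_def atLeast0LessThan del: map_nth)
qed

section \<open>The multiset criterion for monomially graded rings\<close>

text \<open>
  A common frame for the two gradings of the theorem. The component of degree \<open>d\<close> consists of the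
  monomials \<open>s d a\<close> if \<open>m\<close> divides \<open>d\<close>, and is trivial otherwise; \<open>m = 0\<close> is the trivial grading.
\<close>

locale monomial_graded_ring = graded_ring R C
  for R :: "'b::comm_ring_1 ring" and C +
  fixes s :: "int \<Rightarrow> 'a::field \<Rightarrow> 'b" and m :: nat
  assumes mult_eq: "mult R = (*)" and add_eq: "add R = (+)"
    and zero_eq: "zero R = 0" and one_eq: "one R = 1"
    and C_eq: "C d = (if int m dvd d then range (s d) else {0})"
    and s_mult: "s d a * s e b = s (d + e) (a * b)"
    and s_add: "s d (a + b) = s d a + s d b"
    and s_one: "s 0 1 = 1"
begin

lemma s_0 [simp]: "s d 0 = 0"
  using s_add[of d 0 0] by simp

lemma s_sum: "s d (\<Sum>x\<in>X. f x) = (\<Sum>x\<in>X. s d (f x))"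
  by (induction X rule: infinite_finite_induct) (simp_all add: s_add)

lemma C_subset: "C d \<subseteq> carrier R"
  by (rule additive_subgroup.a_subset[OF component_subgroup])

lemma zero_in_C: "0 \<in> C d"
  using additive_subgroup.zero_closed[OF component_subgroup] by (simp add: zero_eq)

lemma one_in_C_0: "1 \<in> C 0"
  using s_one by (auto simp: C_eq intro: range_eqI[of _ _ 1])

lemma C_D: "x \<in> C d \<Longrightarrow> x \<noteq> 0 \<Longrightarrow> int m dvd d"
  by (auto simp: C_eq split: if_splits)

lemma s_in_C: "(a \<noteq> 0 \<Longrightarrow> int m dvd d) \<Longrightarrow> s d a \<in> C d"
  using zero_in_C by (cases "a = 0") (simp_all add: C_eq)

text \<open>In a degree not divisible by \<open>m\<close> the coefficient is taken to be 0, so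
  nonzero coefficients occur only in degrees divisible by \<open>m\<close>.\<close>

lemma C_E:
  assumes "x \<in> C d"
  obtains a where "x = s d a" "a \<noteq> 0 \<longrightarrow> int m dvd d"
proof (cases "int m dvd d")
  case False
  then show ?thesis using assms that[of 0] by (simp add: C_eq)
qed (use assms that in \<open>auto simp: C_eq\<close>)

lemma finsum_eq_sum:
  assumes "finite X" "\<And>x. x \<in> X \<Longrightarrow> f x \<in> carrier R"
  shows "finsum R f X = sum f X"
  using assms
proof (induction X rule: finite_induct)
  case (insert x X)
  then have "f x \<in> carrier R" "f \<in> X \<rightarrow> carrier R" by blast+
  with insert show ?case by (simp add: add_eq)
qed (simp add: zero_eq)

text \<open>Makes determinants and associativity of ordinary matrix multiplication available for the
  ring record.\<close>

lemma matrix_ring_mult: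
  assumes "A \<in> carrier (matrix_ring R n)" "B \<in> carrier (matrix_ring R n)"
  shows "A \<otimes>\<^bsub>matrix_ring R n\<^esub> B = A * B"
proof (rule eq_matI)
  note D = matrix_ring_carrierD[OF assms(1)] matrix_ring_carrierD[OF assms(2)]
  show "dim_row (A \<otimes>\<^bsub>matrix_ring R n\<^esub> B) = dim_row (A * B)"
    "dim_col (A \<otimes>\<^bsub>matrix_ring R n\<^esub> B) = dim_col (A * B)"
    using D by (simp_all add: matrix_ring_def)
  fix i j assume "i < dim_row (A * B)" "j < dim_col (A * B)"
  then have ij: "i < n" "j < n" using D by auto
  then have "(A \<otimes>\<^bsub>matrix_ring R n\<^esub> B) $$ (i, j) = (\<Oplus>\<^bsub>R\<^esub>k\<in>{..<n}. A $$ (i, k) \<otimes>\<^bsub>R\<^esub> B $$ (k, j))"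
    by (simp add: matrix_ring_def)
  also have "\<dots> = (\<Sum>k<n. A $$ (i, k) \<otimes>\<^bsub>R\<^esub> B $$ (k, j))"
    using ij D by (intro finsum_eq_sum) auto
  finally show "(A \<otimes>\<^bsub>matrix_ring R n\<^esub> B) $$ (i, j) = (A * B) $$ (i, j)"
    using ij D by (simp add: mult_eq scalar_prod_def atLeast0LessThan)
qed

lemma matrix_ring_one: "\<one>\<^bsub>matrix_ring R n\<^esub> = 1\<^sub>m n"
  by (auto simp: matrix_ring_def one_mat_def one_eq zero_eq)

lemma matrix_grading_subset: "matrix_grading C \<gamma> d \<subseteq> carrier (matrix_ring R (length \<gamma>))"
  using C_subset by (auto simp: matrix_grading_def matrix_ring_def subset_iff)

lemma matrix_graded_unit_regular_iff_ex:
  "graded_unit_regular (matrix_ring R (length \<gamma>)) (matrix_grading C \<gamma>) \<longleftrightarrow>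
    (\<forall>d. \<forall>X \<in> matrix_grading C \<gamma> d. \<exists>e. \<exists>U \<in> matrix_grading C \<gamma> e.
      \<exists>V \<in> carrier (matrix_ring R (length \<gamma>)).
      U * V = 1\<^sub>m (length \<gamma>) \<and> V * U = 1\<^sub>m (length \<gamma>) \<and> X * U * X = X)"
proof -
  let ?M = "matrix_ring R (length \<gamma>)" and ?G = "matrix_grading C \<gamma>"
  note sub = subsetD[OF matrix_grading_subset]
  have M: "ring ?M" by (rule ring_matrix_ring) (rule ring_axioms)
  have cl: "X * U \<in> carrier ?M" if "X \<in> carrier ?M" "U \<in> carrier ?M" for X U
    using monoid.m_closed[OF ring.is_monoid[OF M] that] matrix_ring_mult[OF that] by simp
  have units: "U \<in> Units ?M \<longleftrightarrow> U \<in> carrier ?M \<and>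
      (\<exists>V\<in>carrier ?M. U * V = 1\<^sub>m (length \<gamma>) \<and> V * U = 1\<^sub>m (length \<gamma>))" for U
    unfolding Units_def by (auto simp: matrix_ring_mult matrix_ring_one)
  have xux: "X \<otimes>\<^bsub>?M\<^esub> U \<otimes>\<^bsub>?M\<^esub> X = X * U * X" if "X \<in> carrier ?M" "U \<in> carrier ?M" for X U
    using that cl by (simp add: matrix_ring_mult)
  have "graded_ring ?M ?G"
    by (rule graded_ring_matrix) (rule graded_ring_axioms)
  then have "graded_unit_regular ?M ?G \<longleftrightarrow>
      (\<forall>d. \<forall>X \<in> ?G d. \<exists>e. \<exists>U \<in> ?G e. U \<in> Units ?M \<and> X \<otimes>\<^bsub>?M\<^esub> U \<otimes>\<^bsub>?M\<^esub> X = X)"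
    unfolding graded_unit_regular_def by blast
  also have "\<dots> \<longleftrightarrow> (\<forall>d. \<forall>X \<in> ?G d. \<exists>e. \<exists>U \<in> ?G e. U \<in> Units ?M \<and> X * U * X = X)"
    using xux sub by (metis (no_types, lifting))
  finally show ?thesis unfolding units using sub by blast
qed

lemma mset_eq_if_graded_unit_regular:
  assumes "graded_unit_regular (matrix_ring R (length \<gamma>)) (matrix_grading C \<gamma>)"
    and p: "p < length \<gamma>" and q: "q < length \<gamma>"
  shows "mset (map (\<lambda>g. g mod int m) \<gamma>) = mset (map (\<lambda>g. (g + (\<gamma> ! p - \<gamma> ! q)) mod int m) \<gamma>)"
proof -
  define n where "n = length \<gamma>"
  \<comment> \<open>A matrix unit: its entry 1 at \<open>(q, p)\<close> has degree 0, so
    \<open>X\<close> has degree \<open>\<gamma> ! q - \<gamma> ! p\<close>. Comparing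
    \<open>X * U * X = X\<close> at \<open>(q, p)\<close> gives \<open>U $$ (p, q) = 1\<close>,
    which determines \<open>e\<close> modulo \<open>m\<close>.\<close>
  define X where "X = mat n n (\<lambda>(i, j). if i = q \<and> j = p then 1 else (0::'b))"
  have "X \<in> matrix_grading C \<gamma> (\<gamma> ! q - \<gamma> ! p)"
    using one_in_C_0 zero_in_C by (auto simp: X_def matrix_grading_def n_def)
  then obtain e U V where U: "U \<in> matrix_grading C \<gamma> e" and V: "V \<in> carrier (matrix_ring R n)"
      and UV: "U * V = 1\<^sub>m n" and X: "X * U * X = X"
    using assms(1) unfolding matrix_graded_unit_regular_iff_ex n_def by blast
  have Uc: "U \<in> carrier_mat n n" and Vc: "V \<in> carrier_mat n n" and Xc: "X \<in> carrier_mat n n"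
    using U matrix_ring_carrierD(1)[OF V] by (auto simp: matrix_grading_def n_def X_def)
  have dvd: "int m dvd - (\<gamma> ! i) + e + \<gamma> ! j" if "i < n" "j < n" "U $$ (i, j) \<noteq> 0" for i j
    using U that by (intro C_D[of "U $$ (i, j)"]) (auto simp: matrix_grading_def n_def)
  have pq: "p < n" "q < n" using p q by (simp_all add: n_def)
  have entry: "(Y * Z) $$ (i, j) = (\<Sum>k = 0..<n. Y $$ (i, k) * Z $$ (k, j))"
    if "Y \<in> carrier_mat n n" "Z \<in> carrier_mat n n" "i < n" "j < n" for Y Z :: "'b mat" and i j
    using that by (simp add: scalar_prod_def)
  have XU: "(X * U) $$ (q, j) = U $$ (p, j)" if "j < n" for j
  proof -
    have "(X * U) $$ (q, j) = (\<Sum>k = 0..<n. X $$ (q, k) * U $$ (k, j))"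
      using entry[OF Xc Uc pq(2) that] .
    also have "\<dots> = (\<Sum>k = 0..<n. if k = p then U $$ (k, j) else 0)"
      using pq by (intro sum.cong) (auto simp: X_def)
    finally show ?thesis using pq by simp
  qed
  have "(X * U * X) $$ (q, p) = (\<Sum>k = 0..<n. (X * U) $$ (q, k) * X $$ (k, p))"
    using entry[OF mult_carrier_mat[OF Xc Uc] Xc pq(2,1)] .
  also have "\<dots> = (\<Sum>k = 0..<n. if k = q then U $$ (p, k) else 0)"
    using pq by (intro sum.cong) (auto simp: XU, auto simp: X_def)
  finally have "U $$ (p, q) = X $$ (q, p)" using pq X by simp
  then have "U $$ (p, q) \<noteq> 0" using pq by (simp add: X_def)
  from dvd[OF pq this] have pq_dvd: "int m dvd - (\<gamma> ! p) + e + \<gamma> ! q" .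
  \<comment> \<open>The determinants of \<open>U\<close> and \<open>V\<close> multiply to 1.\<close>
  have "det U \<noteq> 0"
    using det_mult[OF Uc Vc] UV by auto
  then obtain \<pi> where \<pi>: "\<pi> permutes {..<n}" and nz: "\<And>i. i < n \<Longrightarrow> U $$ (i, \<pi> i) \<noteq> 0"
    using det_eq_0_if_no_transversal[OF Uc] by blast
  \<comment> \<open>Subtracting the divisibilities at \<open>(p, q)\<close> and
    \<open>(i, \<pi> i)\<close> eliminates the unknown degree \<open>e\<close>.\<close>
  have "\<gamma> ! i mod int m = (\<gamma> ! \<pi> i + (\<gamma> ! p - \<gamma> ! q)) mod int m" if "i \<in> {..<n}" for i
  proof -
    have "\<pi> i < n" using permutes_in_image[OF \<pi>] that by blast
    then have "int m dvd (- (\<gamma> ! p) + e + \<gamma> ! q) - (- (\<gamma> ! i) + e + \<gamma> ! \<pi> i)"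
      using dvd[of i "\<pi> i"] nz[of i] that pq_dvd by (intro dvd_diff) auto
    then show ?thesis by (simp add: mod_eq_dvd_iff algebra_simps)
  qed
  from permutes_implies_image_mset_eq[where f = "\<lambda>i. \<gamma> ! i mod int m"
      and f' = "\<lambda>i. (\<gamma> ! i + (\<gamma> ! p - \<gamma> ! q)) mod int m", OF \<pi> this]
  show ?thesis unfolding mset_map_nth n_def by simp
qed

text \<open>The degrees at \<open>(i, k)\<close> and \<open>(k, j)\<close> add up to a value
  independent of \<open>k\<close>, so the coefficients multiply as matrices over the field.\<close>

lemma mult_homogeneous_mat:
  "mat n n (\<lambda>(i, j). s (- (\<gamma> ! i) + d + \<gamma> ! j) (a i j)) *
   mat n n (\<lambda>(i, j). s (- (\<gamma> ! i) + e + \<gamma> ! j) (b i j)) =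
   mat n n (\<lambda>(i, j). s (- (\<gamma> ! i) + (d + e) + \<gamma> ! j) (\<Sum>k<n. a i k * b k j))"
  by (rule eq_matI) (auto simp: scalar_prod_def s_mult s_sum atLeast0LessThan algebra_simps)

lemma graded_unit_regular_if_mset_eq:
  assumes "\<And>p q. \<lbrakk>p < length \<gamma>; q < length \<gamma>\<rbrakk> \<Longrightarrow>
    mset (map (\<lambda>g. g mod int m) \<gamma>) = mset (map (\<lambda>g. (g + (\<gamma> ! p - \<gamma> ! q)) mod int m) \<gamma>)"
  shows "graded_unit_regular (matrix_ring R (length \<gamma>)) (matrix_grading C \<gamma>)"
  unfolding matrix_graded_unit_regular_iff_ex
proof (intro allI ballI)
  fix d X assume X: "X \<in> matrix_grading C \<gamma> d"
  define n where "n = length \<gamma>"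
  \<comment> \<open>\<open>T d a\<close> restores the monomials of a matrix of degree
    \<open>d\<close> with coefficients \<open>a\<close>. All computations below are done on
    coefficients.\<close>
  define T where "T d a = mat n n (\<lambda>(i, j). s (- (\<gamma> ! i) + d + \<gamma> ! j) (a i j))" for d and a :: "nat \<Rightarrow> nat \<Rightarrow> 'a"
  have T_mult: "T d a * T e b = T (d + e) (\<lambda>i j. \<Sum>k<n. a i k * b k j)" for d e a b
    unfolding T_def by (rule mult_homogeneous_mat)
  have T_cong: "T d a = T d b" if "\<And>i j. \<lbrakk>i < n; j < n\<rbrakk> \<Longrightarrow> a i j = b i j" for d a b
    unfolding T_def using that by (intro eq_matI) auto
  have T_one: "T 0 (\<lambda>i j. if i = j then 1 else 0) = 1\<^sub>m n"
    unfolding T_def by (intro eq_matI) (auto simp: s_one)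
  have T_in: "T d a \<in> matrix_grading C \<gamma> d"
    if "\<And>i j. \<lbrakk>i < n; j < n; a i j \<noteq> 0\<rbrakk> \<Longrightarrow> int m dvd - (\<gamma> ! i) + d + \<gamma> ! j" for d a
    using that by (auto simp: T_def matrix_grading_def n_def intro!: s_in_C)
  have "\<forall>i j. \<exists>a. i < n \<longrightarrow> j < n \<longrightarrow> X $$ (i, j) = s (- (\<gamma> ! i) + d + \<gamma> ! j) a \<and>
      (a \<noteq> 0 \<longrightarrow> int m dvd - (\<gamma> ! i) + d + \<gamma> ! j)"
    using X unfolding matrix_grading_def n_def by (blast elim: C_E)
  then obtain a where a: "\<And>i j. \<lbrakk>i < n; j < n\<rbrakk> \<Longrightarrow> X $$ (i, j) = s (- (\<gamma> ! i) + d + \<gamma> ! j) (a i j)"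
      "\<And>i j. \<lbrakk>i < n; j < n; a i j \<noteq> 0\<rbrakk> \<Longrightarrow> int m dvd - (\<gamma> ! i) + d + \<gamma> ! j"
    by metis
  have X_eq: "X = T d a"
    using X a(1) by (intro eq_matI) (auto simp: T_def matrix_grading_def n_def)
  show "\<exists>e. \<exists>U \<in> matrix_grading C \<gamma> e. \<exists>V \<in> carrier (matrix_ring R (length \<gamma>)).
      U * V = 1\<^sub>m (length \<gamma>) \<and> V * U = 1\<^sub>m (length \<gamma>) \<and> X * U * X = X"
  \<comment> \<open>For \<open>X = 0\<close> the identity serves as \<open>U\<close>. Otherwise a
    nonzero entry is needed to compare \<open>d\<close> with a difference of two shifts.\<close>
  proof (cases "\<exists>p<n. \<exists>q<n. a p q \<noteq> 0")
    case False
    then have "X = 0\<^sub>m n n" unfolding X_eq T_def by (intro eq_matI) auto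
    moreover have one: "1\<^sub>m n \<in> matrix_grading C \<gamma> 0"
      using one_in_C_0 zero_in_C by (auto simp: matrix_grading_def n_def)
    ultimately show ?thesis
      using matrix_grading_subset by (intro exI[of _ 0] bexI[of _ "1\<^sub>m n"]) (auto simp: n_def)
  next
    case True
    then obtain p q where pq: "p < n" "q < n" "a p q \<noteq> 0" by blast
    \<comment> \<open>Residues label rows by \<open>c\<close> and columns, shifted by
      \<open>d\<close>, by \<open>c'\<close>; equal labels mark the positions where degree
      \<open>d\<close> admits nonzero entries.\<close>
    define c c' where "c i = \<gamma> ! i mod int m" and "c' j = (d + \<gamma> ! j) mod int m" for i j
    have c: "c i = c' j \<longleftrightarrow> int m dvd - (\<gamma> ! i) + d + \<gamma> ! j" for i j
    proof -
      have "c i = c' j \<longleftrightarrow> c' j = c i" by auto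
      then show ?thesis by (simp add: c_def c'_def mod_eq_dvd_iff algebra_simps)
    qed
    \<comment> \<open>The nonzero entry at \<open>(p, q)\<close> makes \<open>d\<close> congruent to
      \<open>\<gamma> ! p - \<gamma> ! q\<close> modulo \<open>m\<close>, so the assumed invariance
      covers translation by \<open>d\<close> and the blocks are square.\<close>
    have "(\<gamma> ! j + (\<gamma> ! p - \<gamma> ! q)) mod int m = c' j" for j
      using a(2)[OF pq] unfolding c'_def mod_eq_dvd_iff
      by (subst dvd_minus_iff[symmetric]) (simp add: algebra_simps)
    then have mset: "image_mset c (mset_set {..<n}) = image_mset c' (mset_set {..<n})"
      using assms[of p q] pq(1,2) unfolding mset_map_nth n_def c_def by simp
    have compat: "\<forall>i\<in>{..<n}. \<forall>j\<in>{..<n}. a i j \<noteq> 0 \<longrightarrow> c i = c' j"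
      using a(2) unfolding c by simp
    obtain u g where ug:
        "\<forall>i\<in>{..<n}. \<forall>j\<in>{..<n}. u j i \<noteq> 0 \<longrightarrow> c i = c' j"
        "\<forall>i\<in>{..<n}. \<forall>j\<in>{..<n}. g i j \<noteq> 0 \<longrightarrow> c i = c' j"
        "\<forall>j\<in>{..<n}. \<forall>k\<in>{..<n}. (\<Sum>i<n. u j i * g i k) = (if j = k then 1 else 0)"
        "\<forall>i\<in>{..<n}. \<forall>k\<in>{..<n}. (\<Sum>j<n. g i j * u j k) = (if i = k then 1 else 0)"
        "\<forall>i\<in>{..<n}. \<forall>j\<in>{..<n}. (\<Sum>k<n. a i k * (\<Sum>l<n. u k l * a l j)) = a i j"
      using block_matrix_unit_regular[OF finite_lessThan finite_lessThan mset compat]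
      by (elim exE conjE) assumption+
    have U: "T (- d) u \<in> matrix_grading C \<gamma> (- d)"
    proof (rule T_in)
      fix j i assume "j < n" "i < n" "u j i \<noteq> 0"
      then have "int m dvd - (\<gamma> ! i) + d + \<gamma> ! j" using ug(1) c by simp
      then have "int m dvd - (- (\<gamma> ! i) + d + \<gamma> ! j)" by (simp only: dvd_minus_iff)
      then show "int m dvd - (\<gamma> ! j) + - d + \<gamma> ! i" by (simp add: algebra_simps)
    qed
    have V: "T d g \<in> matrix_grading C \<gamma> d"
      by (rule T_in) (use ug(2) c in auto)
    have "T (- d) u * T d g = 1\<^sub>m n" "T d g * T (- d) u = 1\<^sub>m n"
      unfolding T_mult T_one[symmetric] using ug(3,4) by (auto intro!: T_cong)
    moreover have "X * T (- d) u * X = X"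
    proof -
      have "X * T (- d) u * X = X * (T (- d) u * X)"
        unfolding X_eq by (rule assoc_mult_mat[where n\<^sub>1 = n and n\<^sub>2 = n and n\<^sub>3 = n and n\<^sub>4 = n])
          (simp_all add: T_def)
      also have "\<dots> = X" unfolding X_eq T_mult using ug(5) by (auto intro!: T_cong)
      finally show ?thesis .
    qed
    ultimately show ?thesis
      using U subsetD[OF matrix_grading_subset V] unfolding n_def by blast
  qed
qed

theorem matrix_graded_unit_regular_iff:
  "graded_unit_regular (matrix_ring R (length \<gamma>)) (matrix_grading C \<gamma>) \<longleftrightarrow>
    (\<forall>p<length \<gamma>. \<forall>q<length \<gamma>.
      mset (map (\<lambda>g. g mod int m) \<gamma>) = mset (map (\<lambda>g. (g + (\<gamma> ! p - \<gamma> ! q)) mod int m) \<gamma>))"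
  using mset_eq_if_graded_unit_regular graded_unit_regular_if_mset_eq by blast

end

section \<open>The two coefficient rings as instances\<close>

text \<open>For \<open>m = 0\<close>, divisibility of \<open>d\<close> by \<open>m\<close> means
  \<open>d = 0\<close>, so the monomial of coefficient \<open>a\<close> can be \<open>a\<close>
  itself in every degree.\<close>

lemma monomial_graded_ring_trivial:
  "monomial_graded_ring (class_ring :: 'a::field ring) (trivial_grading class_ring) (\<lambda>_ a :: 'a. a) 0"
proof (intro monomial_graded_ring.intro monomial_graded_ring_axioms.intro)
  show "graded_ring (class_ring :: 'a ring) (trivial_grading class_ring)"
    by (rule graded_ring_trivial_grading) (rule class_ring.ring_axioms)
qed (auto simp: trivial_grading_def)

lemma monomial_graded_ring_laurent:
  "monomial_graded_ring (laurent_ring m :: (int \<Rightarrow>\<^sub>0 'a::field) ring) (laurent_grading m)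
     Poly_Mapping.single m"
  by (intro monomial_graded_ring.intro monomial_graded_ring_axioms.intro graded_ring_laurent)
    (auto simp: laurent_grading_def mult_single single_add)

section \<open>Translation-invariant multisets of integers and of residues\<close>

text \<open>Translation changes the sum of the list by \<open>length \<gamma> * d\<close>.\<close>

lemma mset_shift_eq_iff:
  fixes \<gamma> :: "int list"
  shows "mset \<gamma> = mset (map (\<lambda>g. g + d) \<gamma>) \<longleftrightarrow> \<gamma> = [] \<or> d = 0"
proof
  assume "mset \<gamma> = mset (map (\<lambda>g. g + d) \<gamma>)"
  then have "sum_list \<gamma> = sum_list (map (\<lambda>g. g + d) \<gamma>)"
    by (metis sum_mset_sum_list)
  also have "\<dots> = sum_list \<gamma> + int (length \<gamma>) * d"
    by (simp add: sum_list_addf sum_list_triv)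
  finally show "\<gamma> = [] \<or> d = 0" by simp
qed auto

lemma count_list_map_cong:
  "(\<And>a. f a = x \<longleftrightarrow> g a = y) \<Longrightarrow> count_list (map f xs) x = count_list (map g xs) y"
  by (induction xs) simp_all

lemma mset_mod_shift_eq_iff:
  fixes \<gamma> :: "int list"
  assumes "m > 0" "\<forall>i<m. int i \<in> set (map (\<lambda>g. g mod int m) \<gamma>)"
  defines "cnt \<equiv> \<lambda>i. count_list (map (\<lambda>g. g mod int m) \<gamma>) (int i)"
  shows "(\<forall>p<length \<gamma>. \<forall>q<length \<gamma>.
      mset (map (\<lambda>g. g mod int m) \<gamma>) = mset (map (\<lambda>g. (g + (\<gamma> ! p - \<gamma> ! q)) mod int m) \<gamma>)) \<longleftrightarrow>
    (\<exists>k>0. length \<gamma> = k * m \<and> (\<forall>i<m. cnt i = k))"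
  (is "?L \<longleftrightarrow> ?R")
proof
  assume L: ?L
  have eq: "cnt i = cnt 0" if i: "i < m" for i
  proof -
    \<comment> \<open>With \<open>p\<close> in class \<open>i\<close> and \<open>q\<close> in class
      0, translation by \<open>\<gamma> ! p - \<gamma> ! q\<close> carries class 0 onto class
      \<open>i\<close>.\<close>
    obtain p q where p: "p < length \<gamma>" "\<gamma> ! p mod int m = int i"
        and q: "q < length \<gamma>" "\<gamma> ! q mod int m = int 0"
      using assms(1,2) i by (metis (no_types, lifting) in_set_conv_nth length_map nth_map)
    have "(g + (\<gamma> ! p - \<gamma> ! q)) mod int m = int i \<longleftrightarrow> g mod int m = 0" for g
    proof -
      have "(g + (\<gamma> ! p - \<gamma> ! q)) mod int m = int i \<longleftrightarrow>
          (g + (\<gamma> ! p - \<gamma> ! q)) mod int m = \<gamma> ! p mod int m" by (simp add: p)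
      also have "\<dots> \<longleftrightarrow> int m dvd g - \<gamma> ! q" by (simp add: mod_eq_dvd_iff algebra_simps)
      also have "\<dots> \<longleftrightarrow> g mod int m = 0" using q(2) by (simp add: mod_eq_dvd_iff[symmetric])
      finally show ?thesis .
    qed
    then have "count_list (map (\<lambda>g. (g + (\<gamma> ! p - \<gamma> ! q)) mod int m) \<gamma>) (int i) = cnt 0"
      unfolding cnt_def by (intro count_list_map_cong) simp
    moreover have "mset (map (\<lambda>g. g mod int m) \<gamma>) = mset (map (\<lambda>g. (g + (\<gamma> ! p - \<gamma> ! q)) mod int m) \<gamma>)"
      using L p(1) q(1) by blast
    then have "cnt i = count (mset (map (\<lambda>g. (g + (\<gamma> ! p - \<gamma> ! q)) mod int m) \<gamma>)) (int i)"
      unfolding cnt_def count_mset[symmetric] by (rule arg_cong)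
    ultimately show ?thesis unfolding count_mset by (rule trans[rotated])
  qed
  \<comment> \<open>The \<open>m\<close> classes partition the list and have equal counts; class 0
    occurs, so the common count is positive.\<close>
  have "length \<gamma> = (\<Sum>x\<in>int ` {..<m}. count_list (map (\<lambda>g. g mod int m) \<gamma>) x)"
  proof (subst sum_count_set)
    have "g mod int m \<in> int ` {..<m}" for g
      using assms(1) by (intro image_eqI[of _ _ "nat (g mod int m)"]) (auto simp: nat_less_iff)
    then show "set (map (\<lambda>g. g mod int m) \<gamma>) \<subseteq> int ` {..<m}" by auto
  qed auto
  also have "\<dots> = (\<Sum>i<m. cnt i)" by (simp add: sum.reindex cnt_def)
  also have "\<dots> = (\<Sum>i<m. cnt 0)" by (intro sum.cong refl eq) simp
  also have "\<dots> = cnt 0 * m" by simp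
  finally have "length \<gamma> = cnt 0 * m" .
  moreover have "cnt 0 \<noteq> 0" using assms(1,2) unfolding cnt_def count_list_0_iff by blast
  ultimately show ?R using eq by blast
next
  assume ?R
  then obtain k where k: "\<And>i. i < m \<Longrightarrow> cnt i = k" by blast
  \<comment> \<open>Every translate has the same count function. The invariance compares the case
    \<open>d = 0\<close> with a general \<open>d\<close>.\<close>
  have cnt: "count (mset (map (\<lambda>g. (g + d) mod int m) \<gamma>)) x = (if 0 \<le> x \<and> x < int m then k else 0)" for d x
  proof (cases "0 \<le> x \<and> x < int m")
    case True
    \<comment> \<open>The residue class that translation by \<open>d\<close> carries to
      \<open>x\<close>.\<close>
    define y where "y = (x - d) mod int m"
    have "(g + d) mod int m = x \<longleftrightarrow> g mod int m = y" for g
    proof -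
      have "(g + d) mod int m = x \<longleftrightarrow> (g + d) mod int m = x mod int m" using True by simp
      also have "\<dots> \<longleftrightarrow> g mod int m = y" unfolding y_def mod_eq_dvd_iff by (simp add: algebra_simps)
      finally show ?thesis .
    qed
    then have "count (mset (map (\<lambda>g. (g + d) mod int m) \<gamma>)) x = count_list (map (\<lambda>g. g mod int m) \<gamma>) y"
      unfolding count_mset by (intro count_list_map_cong)
    also have "\<dots> = cnt (nat y)" using assms(1) by (simp add: cnt_def y_def)
    also have "\<dots> = k" using assms(1) by (intro k) (simp add: y_def nat_less_iff)
    finally show ?thesis using True by simp
  next
    case False
    then have "x \<notin> set (map (\<lambda>g. (g + d) mod int m) \<gamma>)" using assms(1) by auto
    then show ?thesis unfolding if_not_P[OF False] count_mset_0_iff .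
  qed
  show ?L
    using cnt[of 0] cnt by (intro allI impI multiset_eqI) simp
qed

theorem proposition5p1:
  fixes m n :: nat and \<gamma> :: "int list"
  assumes "m > 0" and "n > 0" and "length \<gamma> = n"
  shows "(graded_unit_regular (matrix_ring (class_ring :: 'a::field ring) n)
            (matrix_grading (trivial_grading (class_ring :: 'a ring)) \<gamma>) \<longleftrightarrow>
          n = 1 \<or> (\<forall>i<n. \<forall>j<n. \<gamma> ! i = \<gamma> ! j)) \<and>
         ((\<forall>i<m. int i \<in> set (map (\<lambda>g. g mod int m) \<gamma>)) \<longrightarrow>
          (graded_unit_regular (matrix_ring (laurent_ring m :: (int \<Rightarrow>\<^sub>0 'a) ring) n)
             (matrix_grading (laurent_grading m :: int \<Rightarrow> (int \<Rightarrow>\<^sub>0 'a) set) \<gamma>) \<longleftrightarrow>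
           (\<exists>k>0. n = k * m \<and>
              (\<forall>i<m. count_list (map (\<lambda>g. g mod int m) \<gamma>) (int i) = k))))"
proof (intro conjI impI)
  have "\<gamma> \<noteq> []" using assms(2,3) by auto
  \<comment> \<open>The criterion at \<open>m = 0\<close>, where \<open>g mod 0 = g\<close> removes
    the reduction.\<close>
  have "graded_unit_regular (matrix_ring (class_ring :: 'a ring) n)
      (matrix_grading (trivial_grading (class_ring :: 'a ring)) \<gamma>) \<longleftrightarrow>
    (\<forall>p<n. \<forall>q<n. mset \<gamma> = mset (map (\<lambda>g. g + (\<gamma> ! p - \<gamma> ! q)) \<gamma>))"
    using monomial_graded_ring.matrix_graded_unit_regular_iff[OF monomial_graded_ring_trivial, of \<gamma>]
    unfolding assms(3) by simp
  also have "\<dots> \<longleftrightarrow> (\<forall>i<n. \<forall>j<n. \<gamma> ! i = \<gamma> ! j)"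
    using \<open>\<gamma> \<noteq> []\<close> by (simp only: mset_shift_eq_iff) simp
  \<comment> \<open>A list of length 1 is constant, so the first disjunct implies the
    second.\<close>
  also have "\<dots> \<longleftrightarrow> n = 1 \<or> (\<forall>i<n. \<forall>j<n. \<gamma> ! i = \<gamma> ! j)" by auto
  finally show "graded_unit_regular (matrix_ring (class_ring :: 'a ring) n)
      (matrix_grading (trivial_grading (class_ring :: 'a ring)) \<gamma>) \<longleftrightarrow>
    n = 1 \<or> (\<forall>i<n. \<forall>j<n. \<gamma> ! i = \<gamma> ! j)" .
next
  assume "\<forall>i<m. int i \<in> set (map (\<lambda>g. g mod int m) \<gamma>)"
  then show "graded_unit_regular (matrix_ring (laurent_ring m :: (int \<Rightarrow>\<^sub>0 'a) ring) n)
      (matrix_grading (laurent_grading m :: int \<Rightarrow> (int \<Rightarrow>\<^sub>0 'a) set) \<gamma>) \<longleftrightarrow>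
    (\<exists>k>0. n = k * m \<and> (\<forall>i<m. count_list (map (\<lambda>g. g mod int m) \<gamma>) (int i) = k))"
    using monomial_graded_ring.matrix_graded_unit_regular_iff[OF monomial_graded_ring_laurent, of m \<gamma>]
      mset_mod_shift_eq_iff[OF assms(1), of \<gamma>] assms(3) by metis
qed

end
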